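(* Let $\mathbf{A}$ be a $0$-$1$ matrix of full row rank with $I$ columns and at least one $1$ in every column, let $RM_{\boldsymbol p}(\mathbf{A})=\{\boldsymbol p\in\mathbb R^I_{>0}:\mathbf1'\boldsymbol p=1,\ \log\boldsymbol p=\mathbf A'\boldsymbol\theta\text{ for some }\boldsymbol\theta\}$, and let $K=\dim(\mathrm{Ker}(\mathbf A))$. Let $\boldsymbol p_0\in RM_{\boldsymbol p}(\mathbf A)$ and $\boldsymbol Y=\boldsymbol Y_N\sim\mathrm{Mult}(N,\boldsymbol p_0)$. Let $\hat{\boldsymbol p}$ be the MLE of $\boldsymbol p_0$ under $RM_{\boldsymbol p}(\mathbf A)$, $\mathscr E$ the set of data values for which it exists, and $\tilde{\boldsymbol p}$ the augmented MLE. Then, as $N\to\infty$, each of $$\mathcal L(X^2(\boldsymbol Y,N\hat{\boldsymbol p})\mid\boldsymbol Y\in\mathscr E),\quad\mathcal L(B(\boldsymbol Y,N\hat{\boldsymbol p})\mid\boldsymbol Y\in\mathscr E),\quad\mathcal L(X^2(\boldsymbol Y,N\tilde{\boldsymbol p})),\quad\mathcal L(B(\boldsymbol Y,N\tilde{\boldsymbol p}))$$ converges to $\chi^2_K$.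
   Context: Vector logs are componentwise. The MLE maximizes $\boldsymbol Y'\log\boldsymbol p$ over the model; $\mathscr E$ is the set of observations for which the maximum is attained in the model. Augmented MLE: $\tilde{\boldsymbol p}=\hat{\boldsymbol p}$ if $\boldsymbol Y\in\mathscr E$ and $(1/I)\mathbf1$ otherwise. For $\boldsymbol u\ge\mathbf0,\boldsymbol v>\mathbf0$: $X^2(\boldsymbol u,\boldsymbol v)=\sum_i(u_i-v_i)^2/v_i$ (Pearson) and $B(\boldsymbol u,\boldsymbol v)=2\sum_i\{u_i\log(u_i/v_i)-(u_i-v_i)\}$ (Bregman), with $0\log0=0$. *)

theory Defs
  imports "HOL-Analysis.Analysis" "HOL-Probability.Probability"
begin

definition RM_p :: "real^'i^'j \<Rightarrow> (real^'i::finite) set" where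
  "RM_p A = {p. (\<forall>i. p$i > 0) \<and> (\<Sum>i\<in>UNIV. p$i) = 1 \<and>
                 (\<exists>\<theta>::real^'j. (\<chi> i. ln (p$i)) = transpose A *v \<theta>)}"

definition kernel_dim :: "real^'i^'j \<Rightarrow> nat" where
  "kernel_dim A = dim {x::real^'i. A *v x = 0}"

definition multinomial :: "nat \<Rightarrow> real^'i \<Rightarrow> (nat^'i::finite) measure" where
  "multinomial N p = density (count_space UNIV)
     (\<lambda>y. ennreal (if (\<Sum>i\<in>UNIV. y$i) = N
                    then fact N / (\<Prod>i\<in>UNIV. fact (y$i)) * (\<Prod>i\<in>UNIV. (p$i) ^ (y$i))
                    else 0))"

definition loglik :: "nat^'i \<Rightarrow> real^'i \<Rightarrow> real" where
  "loglik y p = (\<Sum>i\<in>UNIV. real (y$i) * ln (p$i))"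

definition MLE_exists_set :: "real^'i^'j \<Rightarrow> (nat^'i::finite) set" where
  "MLE_exists_set A = {y. \<exists>p\<in>RM_p A. \<forall>q\<in>RM_p A. loglik y q \<le> loglik y p}"

definition MLE :: "real^'i^'j \<Rightarrow> nat^'i \<Rightarrow> real^'i::finite" where
  "MLE A y = (SOME p. p \<in> RM_p A \<and> (\<forall>q\<in>RM_p A. loglik y q \<le> loglik y p))"

definition aug_MLE :: "real^'i^'j \<Rightarrow> nat^'i \<Rightarrow> real^'i::finite" where
  "aug_MLE A y = (if y \<in> MLE_exists_set A then MLE A y else (\<chi> i. 1 / real CARD('i)))"

definition pearson :: "real^'i \<Rightarrow> real^'i \<Rightarrow> real" where
  "pearson u v = (\<Sum>i\<in>UNIV. (u$i - v$i)^2 / v$i)"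

definition bregman :: "real^'i \<Rightarrow> real^'i \<Rightarrow> real" where
  "bregman u v = 2 * (\<Sum>i\<in>UNIV. (if u$i = 0 then 0 else u$i * ln (u$i / v$i)) - (u$i - v$i))"

definition real_vec :: "nat^'i \<Rightarrow> real^'i" where
  "real_vec y = (\<chi> i. real (y$i))"

definition chi_square :: "nat \<Rightarrow> real measure" where
  "chi_square K = (if K = 0 then return borel 0 else
     density lborel (\<lambda>x. ennreal (if x > 0 then
        x powr (real K / 2 - 1) * exp (- x / 2) / (2 powr (real K / 2) * Gamma (real K / 2))
        else 0)))"

end

theory Submission
  imports Defs "HOL-Real_Asymp.Real_Asymp"
begin

text \<open>
  Let \<open>W\<close> be the vector of counts, centred and divided componentwise by \<open>sqrt (N * p0)\<close>. Near \<open>p0\<close>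
  the score equations say that \<open>sqrt N * (Y / N - MLE) / sqrt p0\<close> is, up to \<open>o(1)\<close> and uniformly for
  bounded \<open>W\<close>, the orthogonal projection of \<open>W\<close> onto a fixed subspace of dimension \<open>dim (Ker A)\<close>
  that is orthogonal to \<open>sqrt p0\<close>; both statistics are asymptotically its squared length \<open>Q\<close>.
  A maximiser beats \<open>p0\<close>, so comparing Kullback-Leibler, Hellinger and chi-square distances keeps it
  within \<open>O(1 / sqrt N)\<close> of \<open>p0\<close>, which also yields existence by compactness.

  For the limit law, \<open>exp (- s * Q)\<close> is a Gaussian average of characters of \<open>W\<close>, and these are explicit
  by the multinomial theorem; hence \<open>E (exp (- k * Q))\<close> tends to \<open>(1 + 2 * k) powr (- K / 2)\<close>. For
  natural \<open>k\<close> these numbers are the moments of \<open>exp (- Q)\<close>, a variable in \<open>[0, 1]\<close>, and determine the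
  weak limit by Weierstrass approximation.
\<close>

section \<open>Weak convergence from Laplace transforms\<close>

text \<open>The row space of \<open>A\<close> may lack the constant vector, so moving along it
  leaves the simplex, and the score equations hold only in directions of mean zero under the
  maximiser itself, a space that moves with the data. Subtracting a multiple of
  \<open>col_sums\<close>, whose mean is positive under every point of the simplex, makes a
  row-space direction admissible, and for a direction tangent at \<open>p0\<close> that multiple
  vanishes as the maximiser approaches \<open>p0\<close>. The projection is found without expanding
  the maximiser. Split \<open>W\<close> as \<open>u + D\<close>, with \<open>u\<close> from counts
  minus fit and \<open>D\<close> from fit minus \<open>p0\<close>, both bounded. The score equations
  make \<open>u\<close> asymptotically orthogonal to \<open>explained\<close>; log-linearity of the
  fit makes \<open>D\<close> asymptotically orthogonal to \<open>residual\<close>. The two spaces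
  are complementary, so \<open>u\<close> must approach the projection of \<open>W\<close>. Bounded
  \<open>W\<close> is justified by tightness, which comes from the same Laplace limit at small
  \<open>s\<close>. The augmented statistics are treated first: they are defined and nonnegative for
  all data, as the Laplace criterion demands, and conditioning on an event of probability tending to
  1 then gives the other two laws.\<close>

lemma integrable_exp_Bernstein:
  fixes \<nu> :: "real measure"
  assumes \<nu>: "real_distribution \<nu>" "AE x in \<nu>. 0 \<le> x"
  shows "integrable \<nu> (\<lambda>x. exp (- x) ^ j * (1 - exp (- x)) ^ l)"
proof -
  interpret real_distribution \<nu> by fact
  show ?thesis
  proof (rule integrable_const_bound[of _ 1])
    show "AE x in \<nu>. norm (exp (- x) ^ j * (1 - exp (- x)) ^ l) \<le> 1"
      using \<nu>(2) by eventually_elim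
        (auto simp: abs_mult power_abs intro!: mult_le_one power_le_one)
  qed simp
qed

text \<open>For \<open>l = 0\<close> these are Laplace transforms at natural arguments, that is,
  moments of \<open>exp (- x)\<close>. Each further factor \<open>1 - exp (- x)\<close> is a
  difference of two integrals with smaller \<open>l\<close>, as in the Hausdorff moment
  problem.\<close>

lemma tendsto_integral_Bernstein_exp:
  fixes M :: "nat \<Rightarrow> real measure" and \<mu> :: "real measure"
  assumes M: "\<And>n. real_distribution (M n)" and \<mu>: "real_distribution \<mu>"
    and M_nonneg: "\<And>n. AE x in M n. 0 \<le> x" and \<mu>_nonneg: "AE x in \<mu>. 0 \<le> x"
    and lim: "\<And>k::nat. (\<lambda>n. \<integral>x. exp (- (real k * x)) \<partial>M n) \<longlonglongrightarrow> (\<integral>x. exp (- (real k * x)) \<partial>\<mu>)"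
  shows "(\<lambda>n. \<integral>x. exp (- x) ^ j * (1 - exp (- x)) ^ l \<partial>M n) \<longlonglongrightarrow> (\<integral>x. exp (- x) ^ j * (1 - exp (- x)) ^ l \<partial>\<mu>)"
proof (induction l arbitrary: j)
  case 0
  have "exp (- x) ^ j = exp (- (real j * x))" for x :: real
    by (simp add: exp_of_nat_mult [symmetric])
  then show ?case using lim[of j] by simp
next
  case (Suc l)
  have step: "(\<integral>x. exp (- x) ^ j * (1 - exp (- x)) ^ Suc l \<partial>\<nu>) =
      (\<integral>x. exp (- x) ^ j * (1 - exp (- x)) ^ l \<partial>\<nu>) - (\<integral>x. exp (- x) ^ Suc j * (1 - exp (- x)) ^ l \<partial>\<nu>)"
    if "real_distribution \<nu>" "AE x in \<nu>. 0 \<le> x" for \<nu>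
  proof (subst Bochner_Integration.integral_diff[symmetric])
    show "integrable \<nu> (\<lambda>x. exp (- x) ^ j * (1 - exp (- x)) ^ l)"
      "integrable \<nu> (\<lambda>x. exp (- x) ^ Suc j * (1 - exp (- x)) ^ l)" by (rule integrable_exp_Bernstein[OF that])+
  qed (auto intro!: Bochner_Integration.integral_cong simp: algebra_simps)
  show ?case
    unfolding step[OF M M_nonneg] step[OF \<mu> \<mu>_nonneg] by (intro tendsto_diff Suc.IH)
qed

text \<open>The substitution \<open>u = exp (- x)\<close> carries the half line into the compact
  interval [0, 1], where Bernstein polynomials approximate uniformly. It suffices to test against
  \<open>cts_step a b\<close>, which vanishes for large \<open>x\<close> and therefore stays
  continuous at \<open>u = 0\<close>.\<close>

theorem weak_conv_m_Laplace:
  fixes M :: "nat \<Rightarrow> real measure" and \<mu> :: "real measure"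
  assumes M: "\<And>n. real_distribution (M n)" and \<mu>: "real_distribution \<mu>"
    and M_nonneg: "\<And>n. AE x in M n. 0 \<le> x" and \<mu>_nonneg: "AE x in \<mu>. 0 \<le> x"
    and lim: "\<And>k::nat. (\<lambda>n. \<integral>x. exp (- (real k * x)) \<partial>M n) \<longlonglongrightarrow> (\<integral>x. exp (- (real k * x)) \<partial>\<mu>)"
  shows "weak_conv_m M \<mu>"
proof (rule integral_cts_step_conv_imp_weak_conv[OF M \<mu>])
  fix a b :: real assume ab: "a < b"
  \<comment> \<open>The lower bound inside \<open>max\<close> keeps the logarithm away from
    \<open>u = 0\<close>. It cuts \<open>x\<close> off at \<open>\<bar>b\<bar> + 1\<close>, beyond
    the point \<open>b\<close> from which on \<open>cts_step a b\<close> is zero, so no value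
    changes.\<close>
  define f where "f u = cts_step a b (- ln (max u (exp (- \<bar>b\<bar> - 1))))" for u
  have cts: "continuous_on UNIV (cts_step a b)"
    by (rule uniformly_continuous_imp_continuous[OF cts_step_uniformly_continuous[OF ab]])
  have pos: "max u (exp (- \<bar>b\<bar> - 1)) \<noteq> 0" for u :: real
    by (smt (verit) exp_gt_zero)
  have f_cont: "continuous_on {0..1} f"
    unfolding f_def
    by (rule continuous_on_compose2[OF cts]) (auto intro!: continuous_intros simp: pos)
  have f_exp: "f (exp (- x)) = cts_step a b x" if "0 \<le> x" for x
  proof (cases "x \<le> \<bar>b\<bar> + 1")
    case True
    then have "max (exp (- x)) (exp (- \<bar>b\<bar> - 1)) = exp (- x)" by auto
    then show ?thesis by (simp add: f_def)
  next
    case False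
    then have "max (exp (- x)) (exp (- \<bar>b\<bar> - 1)) = exp (- \<bar>b\<bar> - 1)" by auto
    then show ?thesis using False ab by (simp add: f_def cts_step_def)
  qed
  define P where "P m x = (\<Sum>k\<le>m. f (k / m) * Bernstein m k (exp (- x)))" for m :: nat and x :: real
  have P_lim: "(\<lambda>n. \<integral>x. P m x \<partial>M n) \<longlonglongrightarrow> (\<integral>x. P m x \<partial>\<mu>)" for m
  proof -
    have eq: "(\<integral>x. P m x \<partial>\<nu>) = (\<Sum>k\<le>m. f (k / m) * (real (m choose k) * (\<integral>x. exp (- x) ^ k * (1 - exp (- x)) ^ (m - k) \<partial>\<nu>)))"
      if "real_distribution \<nu>" "AE x in \<nu>. 0 \<le> x" for \<nu>
      unfolding P_def Bernstein_def mult.assoc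
      by (subst Bochner_Integration.integral_sum) (auto intro!: integrable_exp_Bernstein that)
    show ?thesis
      unfolding eq[OF M M_nonneg] eq[OF \<mu> \<mu>_nonneg]
      by (intro tendsto_sum tendsto_mult tendsto_const
          tendsto_integral_Bernstein_exp[OF M \<mu> M_nonneg \<mu>_nonneg lim])
  qed
  have approx: "\<bar>(\<integral>x. cts_step a b x \<partial>\<nu>) - (\<integral>x. P m x \<partial>\<nu>)\<bar> \<le> e"
    if \<nu>: "real_distribution \<nu>" "AE x in \<nu>. 0 \<le> x"
      and m: "\<And>u. u \<in> {0..1} \<Longrightarrow> \<bar>f u - (\<Sum>k\<le>m. f (k / m) * Bernstein m k u)\<bar> < e" for \<nu> m e
  proof -
    interpret real_distribution \<nu> by fact
    have e: "e > 0" using m[of 0] by auto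
    have close: "AE x in \<nu>. \<bar>cts_step a b x - P m x\<bar> \<le> e"
      using \<nu>(2)
    proof eventually_elim
      case (elim x)
      then show ?case using m[of "exp (- x)"] f_exp[of x] by (simp add: P_def)
    qed
    have [measurable]: "cts_step a b \<in> borel_measurable borel"
      using cts by (rule borel_measurable_continuous_onI)
    have [measurable]: "P m \<in> borel_measurable borel"
      unfolding P_def Bernstein_def by measurable
    have i1: "integrable \<nu> (cts_step a b)" by (rule integrable_cts_step[OF ab])
    have "AE x in \<nu>. norm (P m x) \<le> 1 + e"
      using close
    proof eventually_elim
      case (elim x)
      have "0 \<le> cts_step a b x" "cts_step a b x \<le> 1" using ab by (auto simp: cts_step_def field_simps)
      then show ?case using elim by auto
    qed
    then have i2: "integrable \<nu> (P m)"
      by (intro integrable_const_bound[of _ "1 + e"]) auto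
    have "\<bar>(\<integral>x. cts_step a b x \<partial>\<nu>) - (\<integral>x. P m x \<partial>\<nu>)\<bar> = \<bar>\<integral>x. cts_step a b x - P m x \<partial>\<nu>\<bar>"
      using i1 i2 by simp
    also have "\<dots> \<le> (\<integral>x. \<bar>cts_step a b x - P m x\<bar> \<partial>\<nu>)" by (rule integral_abs_bound)
    also have "\<dots> \<le> (\<integral>x. e \<partial>\<nu>)"
      by (rule integral_mono_AE) (use i1 i2 close in auto)
    finally show ?thesis using prob_space by simp
  qed
  show "(\<lambda>n. integral\<^sup>L (M n) (cts_step a b)) \<longlonglongrightarrow> integral\<^sup>L \<mu> (cts_step a b)"
  proof (rule LIMSEQ_I)
    fix r :: real assume r: "0 < r"
    obtain m where m: "\<And>u. u \<in> {0..1} \<Longrightarrow> \<bar>f u - (\<Sum>k\<le>m. f (k / m) * Bernstein m k u)\<bar> < r / 4"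
      using Bernstein_Weierstrass[OF f_cont, of "r / 4"] r by auto
    obtain no where no: "\<And>n. n \<ge> no \<Longrightarrow> \<bar>(\<integral>x. P m x \<partial>M n) - (\<integral>x. P m x \<partial>\<mu>)\<bar> < r / 4"
      using LIMSEQ_D[OF P_lim[of m], of "r / 4"] r by auto
    show "\<exists>no. \<forall>n\<ge>no. norm (integral\<^sup>L (M n) (cts_step a b) - integral\<^sup>L \<mu> (cts_step a b)) < r"
    proof (intro exI allI impI)
      fix n assume "n \<ge> no"
      show "norm (integral\<^sup>L (M n) (cts_step a b) - integral\<^sup>L \<mu> (cts_step a b)) < r"
        using no[OF \<open>n \<ge> no\<close>] approx[OF M M_nonneg m, of n] approx[OF \<mu> \<mu>_nonneg m] r
        unfolding real_norm_def by linarith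
    qed
  qed
qed

section \<open>The chi-square distribution\<close>

text \<open>Euler's integral for \<open>Gamma a\<close> after the substitution
  \<open>t = c * x\<close>.\<close>

lemma nn_integral_powr_exp:
  fixes a c :: real
  assumes a: "a > 0" and c: "c > 0"
  shows "(\<integral>\<^sup>+x. ennreal (if x > 0 then x powr (a - 1) * exp (- (c * x)) else 0) \<partial>lborel) = ennreal (Gamma a / c powr a)"
proof -
  have "ennreal (Gamma a) = (\<integral>\<^sup>+t. ennreal (indicator {0..} t * t powr (a - 1) / exp t) \<partial>lborel)"
    using Gamma_conv_nn_integral_real[OF a] by simp
  also have "\<dots> = \<bar>c\<bar> * (\<integral>\<^sup>+t. ennreal (indicator {0..} (0 + c * t) * (0 + c * t) powr (a - 1) / exp (0 + c * t)) \<partial>lborel)"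
    by (rule nn_integral_real_affine) (use c in auto)
  also have "\<dots> = (\<integral>\<^sup>+t. ennreal c * ennreal (indicator {0..} (0 + c * t) * (0 + c * t) powr (a - 1) / exp (0 + c * t)) \<partial>lborel)"
    using c by (subst nn_integral_cmult) auto
  also have "\<dots> = (\<integral>\<^sup>+t. ennreal (c powr a) * ennreal (if t > 0 then t powr (a - 1) * exp (- (c * t)) else 0) \<partial>lborel)"
  proof (rule nn_integral_cong)
    fix t :: real
    consider "t > 0" | "t = 0" | "t < 0" by linarith
    then show "ennreal c * ennreal (indicator {0..} (0 + c * t) * (0 + c * t) powr (a - 1) / exp (0 + c * t)) =
        ennreal (c powr a) * ennreal (if t > 0 then t powr (a - 1) * exp (- (c * t)) else 0)"
    proof cases
      case 1
      have "c * (c powr (a - 1) * t powr (a - 1) / exp (c * t)) = c powr a * (t powr (a - 1) * exp (- (c * t)))"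
        using c by (simp add: powr_diff exp_minus field_simps)
      with 1 c show ?thesis
        by (simp add: ennreal_mult'[symmetric] powr_mult)
    next
      case 3
      then have "\<not> 0 \<le> c * t" using c by (simp add: mult_less_0_iff not_le)
      with 3 show ?thesis by simp
    qed simp
  qed
  also have "\<dots> = ennreal (c powr a) * (\<integral>\<^sup>+t. ennreal (if t > 0 then t powr (a - 1) * exp (- (c * t)) else 0) \<partial>lborel)"
    by (rule nn_integral_cmult) measurable
  finally have *: "ennreal (Gamma a) = \<dots>" .
  have "ennreal (1 / c powr a) * ennreal (Gamma a) = (\<integral>\<^sup>+t. ennreal (if t > 0 then t powr (a - 1) * exp (- (c * t)) else 0) \<partial>lborel)"
    unfolding * mult.assoc[symmetric] using c
    by (subst ennreal_mult'[symmetric]) auto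
  then show ?thesis
    using Gamma_real_pos[OF a] by (simp add: ennreal_mult'[symmetric])
qed

text \<open>The exponential tilts a Gamma density into another one with rate \<open>1/2 + s\<close>.
  Nonnegative integrals need no integrability, so the case \<open>s = 0\<close> can later supply the
  total mass 1.\<close>

lemma nn_integral_exp_chi_square:
  assumes s: "s \<ge> (0::real)"
  shows "(\<integral>\<^sup>+x. ennreal (exp (- (s * x))) \<partial>chi_square K) = ennreal ((1 + 2 * s) powr (- real K / 2))"
proof (cases "K = 0")
  case True
  then show ?thesis using s by (simp add: chi_square_def nn_integral_return)
next
  case False
  define a where "a = real K / 2"
  have a: "a > 0" using False by (simp add: a_def)
  define C where "C = 2 powr a * Gamma a"
  have C: "C > 0" using Gamma_real_pos[OF a] by (simp add: C_def)
  have "(\<integral>\<^sup>+x. ennreal (exp (- (s * x))) \<partial>chi_square K) =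
    (\<integral>\<^sup>+x. ennreal (if x > 0 then x powr (a - 1) * exp (- x / 2) / C else 0) * ennreal (exp (- (s * x))) \<partial>lborel)"
    using False unfolding chi_square_def a_def C_def
    by (simp, subst nn_integral_density) auto
  also have "\<dots> = (\<integral>\<^sup>+x. ennreal (1 / C) * ennreal (if x > 0 then x powr (a - 1) * exp (- ((1/2 + s) * x)) else 0) \<partial>lborel)"
  proof (rule nn_integral_cong)
    fix x :: real
    have "exp (- ((1/2 + s) * x)) = exp (- x / 2) * exp (- (s * x))"
      by (simp add: exp_add[symmetric] algebra_simps)
    then show "ennreal (if x > 0 then x powr (a - 1) * exp (- x / 2) / C else 0) * ennreal (exp (- (s * x))) =
      ennreal (1 / C) * ennreal (if x > 0 then x powr (a - 1) * exp (- ((1/2 + s) * x)) else 0)"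
      using C by (simp add: ennreal_mult'[symmetric])
  qed
  also have "\<dots> = ennreal (1 / C) * ennreal (Gamma a / (1/2 + s) powr a)"
    using s by (subst nn_integral_cmult) (auto simp: nn_integral_powr_exp[OF a])
  also have "\<dots> = ennreal ((1 / C) * (Gamma a / (1/2 + s) powr a))"
    using C by (subst ennreal_mult') auto
  also have "(1 / C) * (Gamma a / (1/2 + s) powr a) = 1 / (2 powr a * (1/2 + s) powr a)"
    using Gamma_real_pos[OF a] by (simp add: C_def)
  also have "2 powr a * (1/2 + s) powr a = (1 + 2 * s) powr a"
    using s by (subst powr_mult[symmetric]) (auto simp: algebra_simps)
  also have "1 / (1 + 2 * s) powr a = (1 + 2 * s) powr (- real K / 2)"
    by (simp add: a_def powr_minus_divide)
  finally show ?thesis .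
qed

lemma real_distribution_chi_square: "real_distribution (chi_square K)"
proof -
  have "emeasure (chi_square K) (space (chi_square K)) = 1"
    using nn_integral_exp_chi_square[of 0 K] by simp
  then interpret prob_space "chi_square K" by (rule prob_spaceI)
  show ?thesis
    by unfold_locales (auto simp: chi_square_def)
qed

lemma AE_chi_square_nonneg: "AE x in chi_square K. 0 \<le> x"
proof (cases "K = 0")
  case True
  then show ?thesis unfolding chi_square_def by (auto simp: AE_return)
next
  case False
  then show ?thesis
    unfolding chi_square_def by (auto simp: AE_density)
qed

lemma integral_exp_chi_square:
  assumes s: "s \<ge> (0::real)"
  shows "(\<integral>x. exp (- (s * x)) \<partial>chi_square K) = (1 + 2 * s) powr (- real K / 2)"
proof -
  interpret real_distribution "chi_square K" by (rule real_distribution_chi_square)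
  show ?thesis
    by (subst integral_eq_nn_integral) (auto simp: nn_integral_exp_chi_square[OF s])
qed

section \<open>Multinomial distribution\<close>

text \<open>Induction on \<open>S\<close>: split off the count \<open>k\<close> of the new index and
  apply the binomial theorem. Forcing \<open>y\<close> to vanish outside \<open>S\<close> makes the
  index set finite and the splitting \<open>y \<mapsto> (y a, y(a := 0))\<close> bijective.\<close>

lemma sum_multinomial_fun:
  fixes x :: "'i \<Rightarrow> 'a::field_char_0"
  assumes "finite S"
  shows "(\<Sum>y | (\<forall>i. i \<notin> S \<longrightarrow> y i = 0) \<and> sum y S = n. \<Prod>i\<in>S. x i ^ y i / fact (y i)) = sum x S ^ n / fact n"
  using assms
proof (induction S arbitrary: n)
  case empty
  have "{y :: 'i \<Rightarrow> nat. (\<forall>i. y i = 0) \<and> n = 0} = (if n = 0 then {\<lambda>_. 0} else {})"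
    by auto
  then show ?case by (cases n) (simp_all add: power_0_left eq_commute[of 0] conj_commute)
next
  case (insert a S)
  define F where "F S n = {y :: 'i \<Rightarrow> nat. (\<forall>i. i \<notin> S \<longrightarrow> y i = 0) \<and> sum y S = n}" for S n
  have fin: "finite (F S n)" for n
  proof (rule finite_subset)
    show "F S n \<subseteq> {f. \<forall>i. (i \<in> S \<longrightarrow> f i \<in> {..n}) \<and> (i \<notin> S \<longrightarrow> f i = 0)}"
      using \<open>finite S\<close> by (auto simp: F_def intro: member_le_sum)
    show "finite {f. \<forall>i. (i \<in> S \<longrightarrow> f i \<in> {..n}) \<and> (i \<notin> S \<longrightarrow> f i = (0::nat))}"
      by (rule finite_set_of_finite_funs) (use insert in auto)
  qed
  have sum_upd: "(\<Sum>i\<in>S. if i = a then k else y i) = sum y S" for y :: "'i \<Rightarrow> nat" and k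
    by (rule sum.cong) (use insert in auto)
  have prod_upd: "(\<Prod>i\<in>S. x i ^ (if i = a then k else y i) / fact (if i = a then k else y i)) = (\<Prod>i\<in>S. x i ^ y i / fact (y i))"
    for y :: "'i \<Rightarrow> nat" and k
    by (rule prod.cong) (use insert in auto)
  have "(\<Sum>y\<in>F (insert a S) n. \<Prod>i\<in>insert a S. x i ^ y i / fact (y i)) =
     (\<Sum>(k, y)\<in>(SIGMA k:{..n}. F S (n - k)). x a ^ k / fact k * (\<Prod>i\<in>S. x i ^ y i / fact (y i)))"
  proof (rule sum.reindex_bij_witness[of _ "\<lambda>(k, y). y(a := k)" "\<lambda>y. (y a, y(a := 0))"])
    fix ky assume ky: "ky \<in> (SIGMA k:{..n}. F S (n - k))"
    then obtain k y where [simp]: "ky = (k, y)" and y: "k \<le> n" "y \<in> F S (n - k)" by auto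
    have "y a = 0" using y insert by (auto simp: F_def)
    then show "(\<lambda>y. (y a, y(a := 0))) ((\<lambda>(k, y). y(a := k)) ky) = ky" by auto
    show "(\<lambda>(k, y). y(a := k)) ky \<in> F (insert a S) n"
      using y insert by (auto simp: F_def sum_upd)
  next
    fix y assume y: "y \<in> F (insert a S) n"
    show "(y a, y(a := 0)) \<in> (SIGMA k:{..n}. F S (n - k))"
      using y insert by (auto simp: F_def sum_upd)
    show "(\<lambda>(k, y). x a ^ k / fact k * (\<Prod>i\<in>S. x i ^ y i / fact (y i))) (y a, y(a := 0)) =
      (\<Prod>i\<in>insert a S. x i ^ y i / fact (y i))"
      using insert by (simp add: prod_upd)
  qed auto
  also have "\<dots> = (\<Sum>k\<le>n. \<Sum>y\<in>F S (n - k). x a ^ k / fact k * (\<Prod>i\<in>S. x i ^ y i / fact (y i)))"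
    by (subst sum.Sigma) (auto simp: fin)
  also have "\<dots> = (\<Sum>k\<le>n. x a ^ k / fact k * (sum x S ^ (n - k) / fact (n - k)))"
    unfolding F_def sum_distrib_left[symmetric] insert.IH ..
  also have "\<dots> = (\<Sum>k\<le>n. of_nat (n choose k) * x a ^ k * sum x S ^ (n - k)) / fact n"
    by (subst sum_divide_distrib, rule sum.cong)
      (auto simp: binomial_fact field_simps)
  also have "\<dots> = (x a + sum x S) ^ n / fact n"
    by (simp add: binomial_ring)
  finally show ?case using insert by (simp add: F_def)
qed

definition count_vecs :: "nat \<Rightarrow> (nat^'i::finite) set" where
  "count_vecs N = {y. (\<Sum>i\<in>UNIV. y$i) = N}"

lemma finite_count_vecs: "finite (count_vecs N :: (nat^'i::finite) set)"
proof (rule finite_subset)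
  show "count_vecs N \<subseteq> vec_lambda ` {f :: 'i \<Rightarrow> nat. \<forall>i. (i \<in> UNIV \<longrightarrow> f i \<in> {..N}) \<and> (i \<notin> UNIV \<longrightarrow> f i = 0)}"
  proof
    fix y :: "nat^'i" assume "y \<in> count_vecs N"
    then have "y $ i \<le> N" for i by (auto simp: count_vecs_def intro: member_le_sum)
    then show "y \<in> vec_lambda ` {f :: 'i \<Rightarrow> nat. \<forall>i. (i \<in> UNIV \<longrightarrow> f i \<in> {..N}) \<and> (i \<notin> UNIV \<longrightarrow> f i = 0)}"
      by (intro image_eqI[of _ _ "\<lambda>i. y $ i"]) auto
  qed
  show "finite (vec_lambda ` {f :: 'i \<Rightarrow> nat. \<forall>i. (i \<in> UNIV \<longrightarrow> f i \<in> {..N}) \<and> (i \<notin> UNIV \<longrightarrow> f i = 0)})"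
    by (intro finite_imageI finite_set_of_finite_funs) auto
qed

text \<open>Stated over a field of characteristic 0 because it serves twice: with real weights for
  the total mass and with complex weights for the characters.\<close>

theorem multinomial_theorem:
  fixes x :: "'i::finite \<Rightarrow> 'a::field_char_0"
  shows "(\<Sum>y\<in>count_vecs N. fact N / (\<Prod>i\<in>UNIV. fact (y$i)) * (\<Prod>i\<in>UNIV. x i ^ (y$i))) = (\<Sum>i\<in>UNIV. x i) ^ N"
proof -
  have "(\<Sum>y\<in>count_vecs N. fact N / (\<Prod>i\<in>UNIV. fact (y$i)) * (\<Prod>i\<in>UNIV. x i ^ (y$i)))
    = (\<Sum>y | (\<forall>i. i \<notin> UNIV \<longrightarrow> y i = 0) \<and> sum y UNIV = N. fact N * (\<Prod>i\<in>UNIV. x i ^ y i / fact (y i)))"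
    by (rule sum.reindex_bij_witness[of _ vec_lambda vec_nth])
      (auto simp: count_vecs_def prod_dividef)
  also have "\<dots> = (\<Sum>i\<in>UNIV. x i) ^ N"
    using sum_multinomial_fun[of UNIV x N] by (simp add: sum_distrib_left[symmetric])
  finally show ?thesis .
qed

text \<open>As a \<open>pmf\<close> with finite support the law turns every expectation into a
  finite sum and makes every function integrable.\<close>

definition multinomial_pmf :: "nat \<Rightarrow> real^'i::finite \<Rightarrow> (nat^'i) pmf" where
  "multinomial_pmf N p = embed_pmf (\<lambda>y. if (\<Sum>i\<in>UNIV. y$i) = N
     then fact N / (\<Prod>i\<in>UNIV. fact (y$i)) * (\<Prod>i\<in>UNIV. (p$i) ^ (y$i)) else 0)"

context
  fixes p :: "real^'i::finite"
  assumes p_nonneg: "\<And>i. p$i \<ge> 0" and p_sum: "(\<Sum>i\<in>UNIV. p$i) = 1"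
begin

lemma pmf_multinomial:
  "pmf (multinomial_pmf N p) y = (if (\<Sum>i\<in>UNIV. y$i) = N
     then fact N / (\<Prod>i\<in>UNIV. fact (y$i)) * (\<Prod>i\<in>UNIV. (p$i) ^ (y$i)) else 0)"
  unfolding multinomial_pmf_def
proof (rule pmf_embed_pmf)
  let ?m = "\<lambda>y. if (\<Sum>i\<in>UNIV. y$i) = N
     then fact N / (\<Prod>i\<in>UNIV. fact (y$i)) * (\<Prod>i\<in>UNIV. (p$i) ^ (y$i)) else 0"
  show nonneg: "0 \<le> ?m y" for y
    by (auto intro!: divide_nonneg_nonneg mult_nonneg_nonneg prod_nonneg zero_le_power p_nonneg)
  have "(\<integral>\<^sup>+ y. ennreal (?m y) \<partial>count_space UNIV) = (\<Sum>y\<in>count_vecs N. ennreal (?m y))"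
    by (rule nn_integral_count_space'[OF finite_count_vecs]) (auto simp: count_vecs_def)
  also have "\<dots> = ennreal (\<Sum>y\<in>count_vecs N. ?m y)"
    by (rule sum_ennreal) (rule nonneg)
  also have "(\<Sum>y\<in>count_vecs N. ?m y) = (\<Sum>y\<in>count_vecs N. fact N / (\<Prod>i\<in>UNIV. fact (y$i)) * (\<Prod>i\<in>UNIV. (p$i) ^ (y$i)))"
    by (rule sum.cong) (auto simp: count_vecs_def)
  also have "\<dots> = 1" unfolding multinomial_theorem p_sum by simp
  finally show "(\<integral>\<^sup>+ y. ennreal (?m y) \<partial>count_space UNIV) = 1" by simp
qed

lemma multinomial_eq_pmf: "multinomial N p = measure_pmf (multinomial_pmf N p)"
  by (simp add: multinomial_def measure_pmf_eq_density pmf_multinomial)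

lemma set_pmf_multinomial: "set_pmf (multinomial_pmf N p) \<subseteq> count_vecs N"
  by (auto simp: set_pmf_iff pmf_multinomial count_vecs_def split: if_splits)

lemma finite_set_pmf_multinomial: "finite (set_pmf (multinomial_pmf N p))"
  using finite_subset[OF set_pmf_multinomial finite_count_vecs] .

text \<open>The exponential factors over the cells and is absorbed into the weights, so the
  multinomial theorem applies to \<open>p$i * exp (c i)\<close>. Purely imaginary \<open>c\<close>
  gives the characteristic function.\<close>

lemma expectation_multinomial_exp:
  fixes c :: "'i \<Rightarrow> complex"
  shows "measure_pmf.expectation (multinomial_pmf N p) (\<lambda>y. exp (\<Sum>i\<in>UNIV. of_nat (y$i) * c i)) =
    (\<Sum>i\<in>UNIV. of_real (p$i) * exp (c i)) ^ N"
proof -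
  have "measure_pmf.expectation (multinomial_pmf N p) (\<lambda>y. exp (\<Sum>i\<in>UNIV. of_nat (y$i) * c i)) =
    (\<Sum>y\<in>count_vecs N. pmf (multinomial_pmf N p) y *\<^sub>R exp (\<Sum>i\<in>UNIV. of_nat (y$i) * c i))"
    by (rule integral_measure_pmf[OF finite_count_vecs]) (use set_pmf_multinomial in blast)
  also have "\<dots> = (\<Sum>y\<in>count_vecs N. fact N / (\<Prod>i\<in>UNIV. fact (y$i)) * (\<Prod>i\<in>UNIV. (of_real (p$i) * exp (c i)) ^ (y$i)))"
    by (rule sum.cong)
      (auto simp: pmf_multinomial count_vecs_def scaleR_conv_of_real exp_sum exp_of_nat_mult
         power_mult_distrib prod.distrib)
  also have "\<dots> = (\<Sum>i\<in>UNIV. of_real (p$i) * exp (c i)) ^ N"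
    by (rule multinomial_theorem)
  finally show ?thesis .
qed

end

section \<open>Limit of the standardised counts\<close>

text \<open>The central limit theorem for a centred variable with finitely many values
  \<open>a i\<close>: its characteristic function at scale \<open>1 / sqrt N\<close> is
  \<open>1 - v / (2 * N)\<close> up to \<open>C / (N * sqrt N)\<close>, and \<open>N\<close>-th
  powers of numbers in the unit disc differ by at most \<open>N\<close> times their
  distance.\<close>

lemma tendsto_mean_iexp_power:
  fixes p a :: "'i::finite \<Rightarrow> real"
  assumes p_nonneg: "\<And>i. p i \<ge> 0" and p_sum: "(\<Sum>i\<in>UNIV. p i) = 1"
    and centered: "(\<Sum>i\<in>UNIV. p i * a i) = 0"
  shows "(\<lambda>N. (\<Sum>i\<in>UNIV. p i * iexp (a i / sqrt N)) ^ N)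
    \<longlonglongrightarrow> of_real (exp (- (\<Sum>i\<in>UNIV. p i * (a i)\<^sup>2) / 2))"
proof -
  define \<phi> where "\<phi> N = (\<Sum>i\<in>UNIV. p i * iexp (a i / sqrt (real N)))" for N :: nat
  define v where "v = (\<Sum>i\<in>UNIV. p i * (a i)\<^sup>2)"
  define C where "C = (\<Sum>i\<in>UNIV. p i * \<bar>a i\<bar> ^ 3)"
  have v: "v \<ge> 0" unfolding v_def by (intro sum_nonneg mult_nonneg_nonneg p_nonneg) auto
  have C: "C \<ge> 0" unfolding C_def by (intro sum_nonneg mult_nonneg_nonneg p_nonneg) auto
  have norm_\<phi>: "cmod (\<phi> N) \<le> 1" for N
  proof -
    have "cmod (\<phi> N) \<le> (\<Sum>i\<in>UNIV. cmod (p i * iexp (a i / sqrt N)))"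
      unfolding \<phi>_def by (rule norm_sum)
    also have "\<dots> = 1" using p_sum p_nonneg by (simp add: norm_mult)
    finally show ?thesis .
  qed
  have approx: "cmod (\<phi> N - of_real (1 + (- v / 2) / N)) \<le> C / (N * sqrt N)" if "N > 0" for N
  proof -
    have Taylor: "cmod (iexp t - (1 + \<i> * t - t\<^sup>2 / 2)) \<le> \<bar>t\<bar> ^ 3" for t
    proof -
      have "cmod (iexp t - (\<Sum>k\<le>2. (\<i> * t) ^ k / fact k)) \<le> \<bar>t\<bar> ^ Suc 2 / fact (Suc 2)"
        by (rule iexp_approx1)
      also have "(\<Sum>k\<le>2. (\<i> * t) ^ k / fact k) = 1 + \<i> * t - t\<^sup>2 / 2"
        by (simp add: eval_nat_numeral mult_ac)
      also have "\<bar>t\<bar> ^ Suc 2 / fact (Suc 2) \<le> \<bar>t\<bar> ^ Suc 2 / 1"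
        by (intro divide_left_mono fact_ge_1) auto
      finally show ?thesis by (simp add: eval_nat_numeral)
    qed
    let ?t = "\<lambda>i. a i / sqrt N"
    have diff: "\<phi> N - of_real (1 + (- v / 2) / N) =
      (\<Sum>i\<in>UNIV. p i * (iexp (?t i) - (1 + \<i> * ?t i - (?t i)\<^sup>2 / 2)))"
    proof -
      have "(\<Sum>i\<in>UNIV. complex_of_real (p i) * (1 + \<i> * ?t i - (?t i)\<^sup>2 / 2)) =
        of_real (\<Sum>i\<in>UNIV. p i) + \<i> * (of_real (\<Sum>i\<in>UNIV. p i * a i) / sqrt N) - of_real v / 2 / N"
        using \<open>N > 0\<close> unfolding v_def
        by (simp add: algebra_simps sum.distrib sum_subtractf sum_distrib_left sum_divide_distrib
            power_divide flip: of_real_power of_real_mult)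
      also have "\<dots> = of_real (1 + (- v / 2) / N)"
        by (simp add: p_sum centered)
      finally show ?thesis by (simp only: \<phi>_def right_diff_distrib sum_subtractf)
    qed
    have "cmod (\<phi> N - of_real (1 + (- v / 2) / N)) \<le> (\<Sum>i\<in>UNIV. cmod (p i * (iexp (?t i) - (1 + \<i> * ?t i - (?t i)\<^sup>2 / 2))))"
      unfolding diff by (rule norm_sum)
    also have "\<dots> \<le> (\<Sum>i\<in>UNIV. p i * \<bar>?t i\<bar> ^ 3)"
    proof (rule sum_mono)
      fix i
      show "cmod (p i * (iexp (?t i) - (1 + \<i> * ?t i - (?t i)\<^sup>2 / 2))) \<le> p i * \<bar>?t i\<bar> ^ 3"
        using mult_left_mono[OF Taylor[of "?t i"] p_nonneg[of i]] p_nonneg[of i]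
        by (simp only: norm_mult norm_of_real abs_of_nonneg)
    qed
    also have "\<dots> = C / (N * sqrt N)"
      using \<open>N > 0\<close> unfolding C_def
      by (simp add: sum_divide_distrib power_divide power3_eq_cube)
    finally show ?thesis .
  qed
  \<comment> \<open>From here on \<open>1 - v / (2 * N)\<close> lies in [0, 1], as the comparison of
    powers requires.\<close>
  have "\<forall>\<^sub>F N in sequentially. v / 2 \<le> real N"
    by (rule eventually_compose_filterlim[OF eventually_ge_at_top filterlim_real_sequentially])
  then have "\<forall>\<^sub>F N in sequentially. cmod (\<phi> N ^ N - of_real ((1 + (- v / 2) / N) ^ N)) \<le> C / sqrt N"
    using eventually_gt_at_top[of 0]
  proof eventually_elim
    case (elim N)
    have "cmod (\<phi> N ^ N - of_real (1 + (- v / 2) / N) ^ N) \<le> N * cmod (\<phi> N - of_real (1 + (- v / 2) / N))"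
    proof (rule norm_power_diff[OF norm_\<phi>])
      have "v / 2 / N \<le> 1" "0 \<le> v / 2 / N" using elim v by (auto simp: field_simps)
      then show "cmod (complex_of_real (1 + (- v / 2) / N)) \<le> 1"
        unfolding norm_of_real by simp
    qed
    also have "\<dots> \<le> N * (C / (N * sqrt N))"
      by (intro mult_left_mono approx elim) simp
    finally show ?case using elim by simp
  qed
  moreover have "(\<lambda>N. C / sqrt (real N)) \<longlonglongrightarrow> 0"
    by (intro tendsto_divide_0[OF tendsto_const] filterlim_at_top_imp_at_infinity
        filterlim_compose[OF sqrt_at_top filterlim_real_sequentially])
  ultimately have "(\<lambda>N. \<phi> N ^ N - of_real ((1 + (- v / 2) / N) ^ N)) \<longlonglongrightarrow> 0"
    by (rule Lim_null_comparison)
  moreover have "(\<lambda>N. complex_of_real ((1 + (- v / 2) / N) ^ N)) \<longlonglongrightarrow> of_real (exp (- v / 2))"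
    by (intro tendsto_of_real tendsto_exp_limit_sequentially)
  ultimately have "(\<lambda>N. \<phi> N ^ N) \<longlonglongrightarrow> of_real (exp (- v / 2))"
    by (rule Lim_transform[rotated])
  then show ?thesis by (simp add: \<phi>_def v_def)
qed

section \<open>Gaussian averages\<close>

lemma std_normal_integral_exp_square:
  assumes s: "s \<ge> 0"
  shows "(\<integral>x. exp (- (s * x\<^sup>2)) \<partial>std_normal_distribution) = (1 + 2 * s) powr (- 1 / 2)"
proof -
  \<comment> \<open>Multiplying the standard normal density by
    \<open>exp (- (s * x\<^sup>2))\<close> adds \<open>2 * s\<close> to the inverse variance;
    \<sigma> is the resulting standard deviation.\<close>
  define \<sigma> where "\<sigma> = 1 / sqrt (1 + 2 * s)"
  have \<sigma>: "\<sigma> > 0" "\<sigma>\<^sup>2 = 1 / (1 + 2 * s)" using s by (auto simp: \<sigma>_def power_divide)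
  have "std_normal_density x * exp (- (s * x\<^sup>2)) = \<sigma> * normal_density 0 \<sigma> x" for x
  proof -
    have "exp (- x\<^sup>2 / 2) * exp (- (s * x\<^sup>2)) = exp (- x\<^sup>2 / (2 * \<sigma>\<^sup>2))"
      using s unfolding \<sigma> by (simp add: exp_add[symmetric] field_simps)
    moreover have "sqrt (2 * pi * \<sigma>\<^sup>2) = sqrt (2 * pi) * \<sigma>"
      using \<sigma>(1) by (simp add: real_sqrt_mult)
    ultimately show ?thesis
      using \<sigma>(1) by (simp add: normal_density_def field_simps)
  qed
  then have "(\<integral>x. exp (- (s * x\<^sup>2)) \<partial>std_normal_distribution) = (\<integral>x. \<sigma> * normal_density 0 \<sigma> x \<partial>lborel)"
    by (subst integral_density) auto
  also have "\<dots> = \<sigma>" using \<sigma>(1) by simp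
  finally show ?thesis
    using s by (simp add: \<sigma>_def powr_minus_divide powr_half_sqrt)
qed

lemma Pi_std_normal_iexp:
  fixes c :: "'b \<Rightarrow> real"
  assumes B: "finite B"
  shows "(\<integral>g. iexp (\<Sum>b\<in>B. g b * c b) \<partial>Pi\<^sub>M B (\<lambda>_. std_normal_distribution)) = of_real (exp (- (\<Sum>b\<in>B. (c b)\<^sup>2) / 2))"
proof -
  interpret N: real_distribution std_normal_distribution by (rule real_dist_normal_dist)
  interpret product_sigma_finite "\<lambda>_. std_normal_distribution"
    by (intro product_sigma_finite.intro N.sigma_finite_measure_axioms)
  have "(\<integral>g. iexp (\<Sum>b\<in>B. g b * c b) \<partial>Pi\<^sub>M B (\<lambda>_. std_normal_distribution)) =
    (\<integral>g. (\<Prod>b\<in>B. iexp (c b * g b)) \<partial>Pi\<^sub>M B (\<lambda>_. std_normal_distribution))"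
    by (intro Bochner_Integration.integral_cong)
      (simp_all add: exp_sum[OF B, symmetric] sum_distrib_left mult_ac)
  also have "\<dots> = (\<Prod>b\<in>B. \<integral>x. iexp (c b * x) \<partial>std_normal_distribution)"
    by (rule product_integral_prod[OF B]) (rule N.integrable_iexp, simp_all)
  also have "\<dots> = (\<Prod>b\<in>B. of_real (exp (- (c b)\<^sup>2 / 2)))"
    using char_std_normal_distribution by (simp add: char_def fun_eq_iff)
  also have "\<dots> = of_real (exp (- (\<Sum>b\<in>B. (c b)\<^sup>2) / 2))"
    by (simp add: exp_sum[OF B, symmetric] sum_negf sum_divide_distrib flip: of_real_prod)
  finally show ?thesis .
qed

lemma Pi_std_normal_exp_square:
  assumes B: "finite B" and s: "s \<ge> 0"
  shows "(\<integral>g. exp (- (s * (\<Sum>b\<in>B. (g b)\<^sup>2))) \<partial>Pi\<^sub>M B (\<lambda>_. std_normal_distribution)) = (1 + 2 * s) powr (- real (card B) / 2)"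
proof -
  interpret N: real_distribution std_normal_distribution by (rule real_dist_normal_dist)
  interpret product_sigma_finite "\<lambda>_. std_normal_distribution"
    by (intro product_sigma_finite.intro N.sigma_finite_measure_axioms)
  have "(\<integral>g. exp (- (s * (\<Sum>b\<in>B. (g b)\<^sup>2))) \<partial>Pi\<^sub>M B (\<lambda>_. std_normal_distribution)) =
    (\<integral>g. (\<Prod>b\<in>B. exp (- (s * (g b)\<^sup>2))) \<partial>Pi\<^sub>M B (\<lambda>_. std_normal_distribution))"
    by (intro Bochner_Integration.integral_cong)
      (simp_all add: exp_sum[OF B, symmetric] sum_distrib_left sum_negf)
  also have "\<dots> = (\<Prod>b\<in>B. \<integral>x. exp (- (s * x\<^sup>2)) \<partial>std_normal_distribution)"
    by (rule product_integral_prod[OF B]) (rule N.integrable_const_bound[of _ 1], use s in auto)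
  also have "\<dots> = (1 + 2 * s) powr (- real (card B) / 2)"
    using s by (simp add: std_normal_integral_exp_square powr_power)
  finally show ?thesis .
qed

section \<open>Orthonormal systems and the standardised counts\<close>

definition orthonormal :: "'a::real_inner set \<Rightarrow> bool" where
  "orthonormal B \<longleftrightarrow> finite B \<and> pairwise orthogonal B \<and> (\<forall>b\<in>B. norm b = 1)"

lemma orthonormal_basis_obtain:
  fixes S :: "'a::euclidean_space set"
  assumes "subspace S"
  obtains B where "orthonormal B" "B \<subseteq> S" "card B = dim S" "span B = S"
proof -
  obtain B where B: "B \<subseteq> S" "pairwise orthogonal B" "\<And>b. b \<in> B \<Longrightarrow> norm b = 1" "independent B"
    "card B = dim S" "span B = S"
    using orthonormal_basis_subspace[OF assms] by blast
  moreover have "finite B" using B(4) by (rule independent_imp_finite)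
  ultimately show thesis by (intro that[of B]) (auto simp: orthonormal_def)
qed

lemma orthonormal_norm_sum:
  fixes B :: "'a::real_inner set"
  assumes "orthonormal B"
  shows "(norm (\<Sum>b\<in>B. g b *\<^sub>R b))\<^sup>2 = (\<Sum>b\<in>B. (g b)\<^sup>2)"
proof -
  have "(norm (\<Sum>b\<in>B. g b *\<^sub>R b))\<^sup>2 = (\<Sum>b\<in>B. (norm (g b *\<^sub>R b))\<^sup>2)"
    by (rule norm_sum_Pythagorean)
      (use assms in \<open>auto simp: orthonormal_def pairwise_def orthogonal_clauses\<close>)
  also have "\<dots> = (\<Sum>b\<in>B. (g b)\<^sup>2)" using assms by (simp add: orthonormal_def)
  finally show ?thesis .
qed

lemma orthonormal_Parseval:
  fixes u :: "'a::euclidean_space"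
  assumes "orthonormal B" "u \<in> span B"
  shows "(norm u)\<^sup>2 = (\<Sum>b\<in>B. (b \<bullet> u)\<^sup>2)"
proof -
  have "(\<Sum>b\<in>B. (u \<bullet> b) *\<^sub>R b) = u"
    by (rule orthonormal_basis_expand) (use assms in \<open>auto simp: orthonormal_def\<close>)
  then show ?thesis
    using orthonormal_norm_sum[OF assms(1), of "\<lambda>b. u \<bullet> b"] by (simp add: inner_commute)
qed

text \<open>The Pearson residuals at \<open>p\<close>: for \<open>N > 0\<close> the squared length
  is Pearson's statistic against \<open>p\<close> itself.\<close>

definition std_counts :: "real^'i \<Rightarrow> nat \<Rightarrow> nat^'i \<Rightarrow> real^'i::finite" where
  "std_counts p N y = (\<chi> i. (real (y$i) - real N * p$i) / sqrt (real N * p$i))"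

context
  fixes p :: "real^'i::finite"
  assumes p_pos: "\<And>i. p$i > 0" and p_sum: "(\<Sum>i\<in>UNIV. p$i) = 1"
begin

lemma tendsto_char_std_counts:
  assumes b: "(\<Sum>i\<in>UNIV. b$i * sqrt (p$i)) = 0"
  shows "(\<lambda>N. measure_pmf.expectation (multinomial_pmf N p) (\<lambda>y. iexp (b \<bullet> std_counts p N y)))
    \<longlonglongrightarrow> of_real (exp (- (norm b)\<^sup>2 / 2))"
proof -
  \<comment> \<open>\<open>b \<bullet> std_counts p N y\<close> is the normalised sum of the cell
    function \<open>a\<close> over the \<open>N\<close> draws. Orthogonality of \<open>b\<close> to
    \<open>sqrt p\<close> says that \<open>a\<close> has mean zero, and its variance is the squared
    norm of \<open>b\<close>.\<close>
  define a where "a i = b$i / sqrt (p$i)" for i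
  have p_nonneg: "p$i \<ge> 0" for i using p_pos[of i] by simp
  have pa: "p$i * a i = b$i * sqrt (p$i)" "p$i * (a i)\<^sup>2 = (b$i)\<^sup>2" for i
    using p_pos[of i] by (simp_all add: a_def field_simps power_divide flip: real_sqrt_mult)
  have inner: "b \<bullet> std_counts p N y = (\<Sum>i\<in>UNIV. real (y$i) * (a i / sqrt N))" if "N > 0" for N y
  proof -
    have "b$i * ((real (y$i) - real N * p$i) / sqrt (real N * p$i)) = real (y$i) * (a i / sqrt N) - sqrt N * (b$i * sqrt (p$i))" for i
      using p_pos[of i] that by (simp add: a_def real_sqrt_mult field_simps)
    then have "b \<bullet> std_counts p N y = (\<Sum>i\<in>UNIV. real (y$i) * (a i / sqrt N)) - sqrt N * (\<Sum>i\<in>UNIV. b$i * sqrt (p$i))"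
      by (simp add: std_counts_def inner_vec_def sum_subtractf sum_distrib_left)
    then show ?thesis by (simp add: b)
  qed
  have "measure_pmf.expectation (multinomial_pmf N p) (\<lambda>y. iexp (b \<bullet> std_counts p N y)) =
      (\<Sum>i\<in>UNIV. p$i * iexp (a i / sqrt N)) ^ N" if "N > 0" for N
    unfolding inner[OF that]
    using expectation_multinomial_exp[OF p_nonneg p_sum, of N "\<lambda>i. \<i> * (a i / sqrt N)"]
    by (simp add: sum_distrib_left mult_ac)
  moreover have "(\<lambda>N. (\<Sum>i\<in>UNIV. p$i * iexp (a i / sqrt N)) ^ N)
      \<longlonglongrightarrow> of_real (exp (- (\<Sum>i\<in>UNIV. p$i * (a i)\<^sup>2) / 2))"
    by (rule tendsto_mean_iexp_power) (use p_nonneg p_sum b in \<open>auto simp: pa\<close>)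
  moreover have "(\<Sum>i\<in>UNIV. p$i * (a i)\<^sup>2) = (norm b)\<^sup>2"
    unfolding pa power2_norm_eq_inner inner_vec_def by (simp add: power2_eq_square)
  ultimately show ?thesis
    by (auto elim!: Lim_transform_eventually intro!: eventually_mono[OF eventually_gt_at_top[of 0]])
qed

text \<open>The Gaussian vector \<open>g\<close> linearises the square in the exponent, which reduces the joint limit
  of the coordinates to one-dimensional characteristic functions.\<close>

theorem tendsto_Laplace_std_counts:
  assumes B: "orthonormal B"
    and B_perp: "\<And>b. b \<in> B \<Longrightarrow> (\<Sum>i\<in>UNIV. b$i * sqrt (p$i)) = 0"
    and s: "s \<ge> 0"
  shows "(\<lambda>N. measure_pmf.expectation (multinomial_pmf N p)
      (\<lambda>y. exp (- (s * (\<Sum>b\<in>B. (b \<bullet> std_counts p N y)\<^sup>2)))))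
    \<longlonglongrightarrow> (1 + 2 * s) powr (- real (card B) / 2)"
proof -
  have fB: "finite B" using B by (simp add: orthonormal_def)
  define G where "G = Pi\<^sub>M B (\<lambda>_. std_normal_distribution)"
  interpret N: real_distribution std_normal_distribution by (rule real_dist_normal_dist)
  interpret G: prob_space G
    unfolding G_def by (intro prob_space_PiM N.prob_space_axioms)
  \<comment> \<open>The factor \<open>sqrt (2 * s)\<close> cancels the 1/2 of the Gaussian exponent:
    averaging characters over \<open>g\<close> gives \<open>exp (- s * Q)\<close>, and the limit in
    direction \<open>h g\<close> is \<open>exp\<close> of \<open>- s\<close> times the squared
    length of \<open>g\<close>.\<close>
  define h where "h g = sqrt (2 * s) *\<^sub>R (\<Sum>b\<in>B. g b *\<^sub>R b)" for g :: "real^'i \<Rightarrow> real"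
  have p_nonneg: "p$i \<ge> 0" for i using p_pos[of i] by simp
  have [measurable]: "(\<lambda>g. g b) \<in> borel_measurable G" if "b \<in> B" for b
    using measurable_component_singleton[OF that, of "\<lambda>_. std_normal_distribution"]
    by (simp add: G_def)
  have h_inner: "h g \<bullet> w = (\<Sum>b\<in>B. g b * (sqrt (2 * s) * (b \<bullet> w)))" for g w
    by (simp add: h_def inner_sum_left sum_distrib_left mult_ac)
  have h_norm: "(norm (h g))\<^sup>2 = 2 * s * (\<Sum>b\<in>B. (g b)\<^sup>2)" for g
    using s by (simp add: h_def power_mult_distrib orthonormal_norm_sum[OF B])
  have int: "integrable G (\<lambda>g. iexp (h g \<bullet> w))" for w
    by (rule G.integrable_iexp) (simp_all add: h_inner)
  have E_sum: "measure_pmf.expectation (multinomial_pmf N p) f =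
      (\<Sum>y\<in>count_vecs N. pmf (multinomial_pmf N p) y *\<^sub>R f y)" for N and f :: "_ \<Rightarrow> complex"
    by (rule integral_measure_pmf[OF finite_count_vecs])
      (use set_pmf_multinomial[OF p_nonneg p_sum] in blast)
  have swap: "measure_pmf.expectation (multinomial_pmf N p)
      (\<lambda>y. complex_of_real (exp (- (s * (\<Sum>b\<in>B. (b \<bullet> std_counts p N y)\<^sup>2))))) =
    (\<integral>g. measure_pmf.expectation (multinomial_pmf N p) (\<lambda>y. iexp (h g \<bullet> std_counts p N y)) \<partial>G)" for N
  proof -
    have "complex_of_real (exp (- (s * (\<Sum>b\<in>B. (b \<bullet> w)\<^sup>2)))) = (\<integral>g. iexp (h g \<bullet> w) \<partial>G)" for w
    proof -
      have "(\<Sum>b\<in>B. (sqrt (2 * s) * (b \<bullet> w))\<^sup>2) = 2 * (s * (\<Sum>b\<in>B. (b \<bullet> w)\<^sup>2))"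
        using s by (simp add: power_mult_distrib sum_distrib_left mult_ac)
      then show ?thesis
        using Pi_std_normal_iexp[OF fB, of "\<lambda>b. sqrt (2 * s) * (b \<bullet> w)"]
        by (simp add: G_def h_inner)
    qed
    then show ?thesis
      unfolding E_sum by (subst Bochner_Integration.integral_sum) (auto simp: int)
  qed
  have "(\<lambda>N. \<integral>g. measure_pmf.expectation (multinomial_pmf N p) (\<lambda>y. iexp (h g \<bullet> std_counts p N y)) \<partial>G)
    \<longlonglongrightarrow> (\<integral>g. complex_of_real (exp (- (s * (\<Sum>b\<in>B. (g b)\<^sup>2)))) \<partial>G)"
  proof (rule integral_dominated_convergence[where w = "\<lambda>_. 1"])
    show "(\<lambda>g. complex_of_real (exp (- (s * (\<Sum>b\<in>B. (g b)\<^sup>2))))) \<in> borel_measurable G"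
      by measurable
    show "(\<lambda>g. measure_pmf.expectation (multinomial_pmf N p) (\<lambda>y. iexp (h g \<bullet> std_counts p N y))) \<in> borel_measurable G" for N
      unfolding E_sum using int[THEN borel_measurable_integrable] by measurable
    show "AE g in G. (\<lambda>N. measure_pmf.expectation (multinomial_pmf N p) (\<lambda>y. iexp (h g \<bullet> std_counts p N y)))
      \<longlonglongrightarrow> complex_of_real (exp (- (s * (\<Sum>b\<in>B. (g b)\<^sup>2))))"
    proof (rule AE_I2)
      fix g
      have "(\<Sum>i\<in>UNIV. h g $ i * sqrt (p$i)) = sqrt (2 * s) * (\<Sum>b\<in>B. g b * (\<Sum>i\<in>UNIV. b$i * sqrt (p$i)))"
        by (simp add: h_def sum_distrib_left sum_distrib_right mult_ac) (rule sum.swap)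
      also have "\<dots> = 0" using B_perp by simp
      finally show "(\<lambda>N. measure_pmf.expectation (multinomial_pmf N p) (\<lambda>y. iexp (h g \<bullet> std_counts p N y)))
      \<longlonglongrightarrow> complex_of_real (exp (- (s * (\<Sum>b\<in>B. (g b)\<^sup>2))))"
        using tendsto_char_std_counts[of "h g"] by (simp add: h_norm)
    qed
    show "AE g in G. cmod (measure_pmf.expectation (multinomial_pmf N p) (\<lambda>y. iexp (h g \<bullet> std_counts p N y))) \<le> 1" for N
    proof (rule AE_I2)
      fix g
      have "cmod (measure_pmf.expectation (multinomial_pmf N p) (\<lambda>y. iexp (h g \<bullet> std_counts p N y)))
        \<le> measure_pmf.expectation (multinomial_pmf N p) (\<lambda>y. cmod (iexp (h g \<bullet> std_counts p N y)))"
        by (rule integral_norm_bound)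
      then show "cmod (measure_pmf.expectation (multinomial_pmf N p) (\<lambda>y. iexp (h g \<bullet> std_counts p N y))) \<le> 1"
        by simp
    qed
  qed simp
  then have "(\<lambda>N. complex_of_real (measure_pmf.expectation (multinomial_pmf N p)
      (\<lambda>y. exp (- (s * (\<Sum>b\<in>B. (b \<bullet> std_counts p N y)\<^sup>2)))))) \<longlonglongrightarrow> complex_of_real ((1 + 2 * s) powr (- real (card B) / 2))"
    unfolding swap[symmetric] by (simp add: Pi_std_normal_exp_square[OF fB s] G_def)
  then show ?thesis by (simp only: tendsto_of_real_iff)
qed

end

section \<open>Likelihood in the relational model\<close>

text \<open>The chain is Hellinger(q, p) \<le> KL(q, p) \<le> KL(q, r) \<le> chi-square(q, r), the
  middle step being \<open>le\<close>; the factor 4 bounds the square of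
  \<open>sqrt (q i) + sqrt (p i)\<close>. The bound contains no lower bound on \<open>p\<close>, so
  it also controls candidates near the boundary of the simplex.\<close>

lemma Hellinger_bound:
  fixes q p r :: "'i::finite \<Rightarrow> real"
  assumes q: "\<And>i. q i \<ge> 0" "(\<Sum>i\<in>UNIV. q i) = 1"
    and p: "\<And>i. p i > 0" "(\<Sum>i\<in>UNIV. p i) = 1"
    and r: "\<And>i. r i > 0" "(\<Sum>i\<in>UNIV. r i) = 1"
    and le: "(\<Sum>i\<in>UNIV. q i * ln (r i)) \<le> (\<Sum>i\<in>UNIV. q i * ln (p i))"
  shows "(q i - p i)\<^sup>2 \<le> 4 * (\<Sum>i\<in>UNIV. (q i - r i)\<^sup>2 / r i)"
proof -
  \<comment> \<open>This is \<open>ln x \<le> x - 1\<close> at \<open>x = sqrt (p j / q j)\<close>;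
    \<open>upper\<close> uses the same inequality at \<open>x = q j / r j\<close>.\<close>
  have lower: "2 * q j - 2 * sqrt (p j * q j) \<le> q j * (ln (q j) - ln (p j))" for j
  proof (cases "q j = 0")
    case False
    then have qj: "q j > 0" using q(1)[of j] by simp
    have "q j * ln (sqrt (p j / q j)) \<le> q j * (sqrt (p j / q j) - 1)"
      using qj p(1)[of j] by (intro mult_left_mono ln_le_minus_one) auto
    moreover have "ln (sqrt (p j / q j)) = (ln (p j) - ln (q j)) / 2"
      using qj p(1)[of j] by (simp add: ln_sqrt ln_div)
    moreover have "q j * sqrt (p j / q j) = sqrt (p j * q j)"
      using qj p(1)[of j] by (simp add: real_sqrt_divide real_sqrt_mult field_simps)
    ultimately have "(q j * ln (p j) - q j * ln (q j)) / 2 \<le> sqrt (p j * q j) - q j"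
      by (simp only: right_diff_distrib times_divide_eq_right mult_1_right)
    then show ?thesis by (simp add: right_diff_distrib field_simps)
  qed simp
  have upper: "q j * (ln (q j) - ln (r j)) \<le> (q j - r j)\<^sup>2 / r j + (q j - r j)" for j
  proof (cases "q j = 0")
    case True
    then show ?thesis using r(1)[of j] by (simp add: power2_eq_square)
  next
    case False
    then have qj: "q j > 0" using q(1)[of j] by simp
    have "ln (q j / r j) \<le> q j / r j - 1"
      using qj r(1)[of j] by (intro ln_le_minus_one) simp
    then have "q j * (ln (q j) - ln (r j)) \<le> q j * (q j / r j - 1)"
      using qj r(1)[of j] by (simp add: ln_div)
    also have "\<dots> = (q j - r j)\<^sup>2 / r j + (q j - r j)"
      using r(1)[of j] by (simp add: field_simps power2_eq_square)
    finally show ?thesis .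
  qed
  have "(\<Sum>j\<in>UNIV. (sqrt (q j) - sqrt (p j))\<^sup>2) = (\<Sum>j\<in>UNIV. (2 * q j - 2 * sqrt (p j * q j)) + (p j - q j))"
    using q(1) p(1) by (intro sum.cong) (auto simp: power2_diff real_sqrt_mult less_imp_le)
  also have "\<dots> = (\<Sum>j\<in>UNIV. 2 * q j - 2 * sqrt (p j * q j))"
    using q(2) p(2) by (simp add: sum.distrib sum_subtractf sum_distrib_left[symmetric])
  also have "\<dots> \<le> (\<Sum>j\<in>UNIV. q j * (ln (q j) - ln (p j)))"
    by (intro sum_mono lower)
  also have "\<dots> \<le> (\<Sum>j\<in>UNIV. q j * (ln (q j) - ln (r j)))"
    using le by (simp add: right_diff_distrib sum_subtractf)
  also have "\<dots> \<le> (\<Sum>j\<in>UNIV. (q j - r j)\<^sup>2 / r j + (q j - r j))"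
    by (intro sum_mono upper)
  also have "\<dots> = (\<Sum>j\<in>UNIV. (q j - r j)\<^sup>2 / r j)"
    using q(2) r(2) by (simp add: sum.distrib sum_subtractf)
  finally have H: "(\<Sum>j\<in>UNIV. (sqrt (q j) - sqrt (p j))\<^sup>2) \<le> (\<Sum>j\<in>UNIV. (q j - r j)\<^sup>2 / r j)" .
  have le1: "q i \<le> 1" "p i \<le> 1"
    using member_le_sum[of i UNIV q] member_le_sum[of i UNIV p] q p by (auto simp: less_imp_le)
  have "q i - p i = (sqrt (q i) - sqrt (p i)) * (sqrt (q i) + sqrt (p i))"
    using q(1)[of i] p(1)[of i] by (simp add: algebra_simps)
  then have "(q i - p i)\<^sup>2 = (sqrt (q i) - sqrt (p i))\<^sup>2 * (sqrt (q i) + sqrt (p i))\<^sup>2"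
    by (simp add: power_mult_distrib)
  moreover have "(sqrt (q i) + sqrt (p i))\<^sup>2 \<le> 2\<^sup>2"
  proof (rule power_mono)
    have "sqrt (q i) \<le> 1" "sqrt (p i) \<le> 1" using le1 by simp_all
    then show "sqrt (q i) + sqrt (p i) \<le> 2" by linarith
  qed (use q(1)[of i] p(1)[of i] in auto)
  then have "(sqrt (q i) - sqrt (p i))\<^sup>2 * (sqrt (q i) + sqrt (p i))\<^sup>2 \<le> (sqrt (q i) - sqrt (p i))\<^sup>2 * 2\<^sup>2"
    by (rule mult_left_mono) simp
  ultimately have "(q i - p i)\<^sup>2 \<le> 4 * (sqrt (q i) - sqrt (p i))\<^sup>2"
    by simp
  also have "\<dots> \<le> 4 * (\<Sum>j\<in>UNIV. (sqrt (q j) - sqrt (p j))\<^sup>2)"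
    by (intro mult_left_mono member_le_sum) auto
  finally show ?thesis using H by simp
qed

definition MLE_spec :: "real^'i^'j \<Rightarrow> nat^'i \<Rightarrow> real^'i::finite \<Rightarrow> bool" where
  "MLE_spec A y p \<longleftrightarrow> p \<in> RM_p A \<and> (\<forall>q\<in>RM_p A. loglik y q \<le> loglik y p)"

lemma MLE_spec_MLE: "y \<in> MLE_exists_set A \<Longrightarrow> MLE_spec A y (MLE A y)"
  unfolding MLE_exists_set_def MLE_def MLE_spec_def by (rule someI_ex) auto

locale relational_model =
  fixes A :: "real^'i::finite^'j::finite" and p0 :: "real^'i"
  assumes zero_one: "\<forall>j i. A$j$i = 0 \<or> A$j$i = 1"
    and col_one: "\<forall>i. \<exists>j. A$j$i = 1"
    and p0: "p0 \<in> RM_p A"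
begin

definition row_space :: "(real^'i) set" where
  "row_space = range (\<lambda>\<theta>. transpose A *v \<theta>)"

text \<open>A vector of the row space with all entries at least 1. It stands in for the intercept
  that the model may lack.\<close>

definition col_sums :: "real^'i" where
  "col_sums = transpose A *v 1"

lemma subspace_row_space: "subspace row_space"
  unfolding row_space_def by (rule linear_subspace_image) auto

lemma col_sums_in_row_space: "col_sums \<in> row_space"
  by (auto simp: row_space_def col_sums_def)

lemma col_sums_ge_1: "col_sums $ i \<ge> 1"
proof -
  obtain j where "A$j$i = 1" using col_one by blast
  then have "1 = A$j$i" by simp
  also have "\<dots> \<le> (\<Sum>j\<in>UNIV. A$j$i)"
  proof (intro member_le_sum)
    show "0 \<le> A$k$i" for k using zero_one[rule_format, of k i] by auto
  qed auto
  also have "\<dots> = col_sums $ i"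
    by (simp add: col_sums_def matrix_vector_mult_def transpose_def)
  finally show ?thesis .
qed

lemma RM_p_iff: "p \<in> RM_p A \<longleftrightarrow> (\<forall>i. p$i > 0) \<and> (\<Sum>i\<in>UNIV. p$i) = 1 \<and> (\<chi> i. ln (p$i)) \<in> row_space"
  by (auto simp: RM_p_def row_space_def)

lemma RM_pD:
  assumes "p \<in> RM_p A"
  shows "p$i > 0" "(\<Sum>i\<in>UNIV. p$i) = 1" "(\<chi> i. ln (p$i)) \<in> row_space"
  using assms by (auto simp: RM_p_iff)

lemma sum_col_sums_pos:
  assumes "\<And>i. p$i > 0"
  shows "(\<Sum>i\<in>UNIV. p$i * col_sums$i) > 0"
  using assms col_sums_ge_1 by (intro sum_pos mult_pos_pos) (auto intro: less_le_trans[OF zero_less_one])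

text \<open>Moving along \<open>\<eta>\<close> leaves the simplex; a multiple \<open>c\<close> of the positive vector \<open>col_sums\<close> brings
  the point back, and \<open>c\<close> is of second order because the total mass is stationary along \<open>\<eta>\<close>.\<close>

lemma RM_p_curve:
  assumes p: "p \<in> RM_p A" and \<eta>: "\<eta> \<in> row_space"
  obtains c where "\<bar>c\<bar> \<le> \<bar>ln (\<Sum>i\<in>UNIV. p$i * exp (\<eta>$i))\<bar>"
    and "(\<chi> i. p$i * exp (\<eta>$i + c * col_sums$i)) \<in> RM_p A"
proof -
  define g where "g c = (\<Sum>i\<in>UNIV. p$i * exp (\<eta>$i + c * col_sums$i))" for c
  have g0: "g 0 = (\<Sum>i\<in>UNIV. p$i * exp (\<eta>$i))" by (simp add: g_def)
  have pos: "g 0 > 0" unfolding g0 using RM_pD(1)[OF p] by (intro sum_pos) auto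
  \<comment> \<open>Adding the constant \<open>- ln (g 0)\<close> to all exponents would restore
    mass 1. Entries of \<open>col_sums\<close> are at least 1, so \<open>c = L\<close> makes the
    mass at least 1 and \<open>c = - L\<close> at most 1; the intermediate value theorem does the
    rest.\<close>
  define L where "L = \<bar>ln (g 0)\<bar>"
  have cont: "continuous_on {-L..L} g" unfolding g_def by (intro continuous_intros)
  have "g 0 * exp L = (\<Sum>i\<in>UNIV. p$i * exp (\<eta>$i + L))"
    by (simp add: g_def exp_add sum_distrib_right sum_distrib_left mult_ac)
  also have "\<dots> \<le> g L"
    unfolding g_def using RM_pD(1)[OF p] col_sums_ge_1
    by (intro sum_mono mult_left_mono) (auto simp: less_imp_le L_def mult_le_cancel_left1)
  finally have "g 0 * exp L \<le> g L" .
  moreover have "1 \<le> g 0 * exp L"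
  proof -
    have "exp (- L) \<le> exp (ln (g 0))" by (simp add: L_def)
    then show ?thesis using pos by (simp add: exp_minus field_simps)
  qed
  ultimately have gL: "1 \<le> g L" by simp
  have "g (- L) \<le> (\<Sum>i\<in>UNIV. p$i * exp (\<eta>$i - L))"
    unfolding g_def using RM_pD(1)[OF p] col_sums_ge_1
    by (intro sum_mono mult_left_mono) (auto simp: less_imp_le L_def mult_le_cancel_left1)
  also have "\<dots> = g 0 / exp L"
    by (simp add: g_def exp_diff sum_divide_distrib)
  also have "\<dots> \<le> 1"
  proof -
    have "exp (ln (g 0)) \<le> exp L" by (simp add: L_def)
    then show ?thesis using pos by simp
  qed
  finally have "g (- L) \<le> 1" .
  with gL cont obtain c where c: "- L \<le> c" "c \<le> L" "g c = 1"
    using IVT'[of g "- L" 1 L] by (auto simp: L_def)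
  have "(\<chi> i. ln ((\<chi> i. p$i * exp (\<eta>$i + c * col_sums$i)) $ i)) = (\<chi> i. ln (p$i)) + \<eta> + c *\<^sub>R col_sums"
    using RM_pD(1)[OF p] by (simp add: vec_eq_iff ln_mult_pos)
  also have "\<dots> \<in> row_space"
    by (intro subspace_add subspace_scale subspace_row_space RM_pD(3)[OF p] \<eta> col_sums_in_row_space)
  finally have "(\<chi> i. p$i * exp (\<eta>$i + c * col_sums$i)) \<in> RM_p A"
    unfolding RM_p_iff using RM_pD(1)[OF p] c(3) by (auto simp: g_def)
  moreover have "\<bar>c\<bar> \<le> \<bar>ln (\<Sum>i\<in>UNIV. p$i * exp (\<eta>$i))\<bar>"
    using c by (simp add: L_def g0)
  ultimately show thesis using that by blast
qed

text \<open>Optimality is tested on the curve of \<open>RM_p_curve\<close> in direction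
  \<open>t *\<^sub>R \<eta>\<close>. By tangency the mass \<open>g t\<close> is stationary at 0, so
  the correction \<open>c\<close> is \<open>o(t)\<close> and its effect on the likelihood disappears
  after division by \<open>t\<close>.\<close>

lemma score_le:
  assumes p: "MLE_spec A y p" and \<eta>: "\<eta> \<in> row_space" and tangent: "(\<Sum>i\<in>UNIV. p$i * \<eta>$i) = 0"
  shows "(\<Sum>i\<in>UNIV. real (y$i) * \<eta>$i) \<le> 0"
proof -
  have pR: "p \<in> RM_p A" and max: "\<And>q. q \<in> RM_p A \<Longrightarrow> loglik y q \<le> loglik y p"
    using p by (auto simp: MLE_spec_def)
  define g where "g t = (\<Sum>i\<in>UNIV. p$i * exp (t * \<eta>$i))" for t
  define S where "S = (\<Sum>i\<in>UNIV. real (y$i) * col_sums$i)"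
  have S: "S \<ge> 0"
    unfolding S_def using col_sums_ge_1 by (intro sum_nonneg mult_nonneg_nonneg) (auto intro: order_trans[OF zero_le_one])
  have "(\<Sum>i\<in>UNIV. real (y$i) * \<eta>$i) \<le> \<bar>ln (g t) / t\<bar> * S" if t: "t > 0" for t
  proof -
    have "t *\<^sub>R \<eta> \<in> row_space" by (intro subspace_scale subspace_row_space \<eta>)
    from RM_p_curve[OF pR this] obtain c where c: "\<bar>c\<bar> \<le> \<bar>ln (g t)\<bar>"
      and R: "(\<chi> i. p$i * exp (t * \<eta>$i + c * col_sums$i)) \<in> RM_p A"
      by (auto simp: g_def)
    have "loglik y (\<chi> i. p$i * exp (t * \<eta>$i + c * col_sums$i)) = loglik y p + t * (\<Sum>i\<in>UNIV. real (y$i) * \<eta>$i) + c * S"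
      using RM_pD(1)[OF pR]
      by (simp add: loglik_def S_def ln_mult_pos algebra_simps sum.distrib sum_distrib_left)
    with max[OF R] have "t * (\<Sum>i\<in>UNIV. real (y$i) * \<eta>$i) \<le> - c * S" by simp
    also have "\<dots> \<le> \<bar>ln (g t)\<bar> * S" using c S by (intro mult_right_mono) auto
    finally show ?thesis using t by (simp add: field_simps)
  qed
  then have ev: "\<forall>\<^sub>F t in at_right 0. (\<Sum>i\<in>UNIV. real (y$i) * \<eta>$i) \<le> \<bar>ln (g t) / t\<bar> * S"
    by (auto simp: eventually_at_filter)
  have "((\<lambda>t. \<bar>ln (g t) / t\<bar> * S) \<longlongrightarrow> \<bar>0\<bar> * S) (at_right 0)"
  proof (intro tendsto_mult tendsto_rabs tendsto_const)
    have g0: "g 0 = 1" using RM_pD(2)[OF pR] by (simp add: g_def)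
    have "(g has_real_derivative (\<Sum>i\<in>UNIV. p$i * \<eta>$i)) (at 0)"
      unfolding g_def by (auto intro!: derivative_eq_intros simp: mult.commute)
    then have "(g has_real_derivative 0) (at 0)" by (simp add: tangent)
    then have "((\<lambda>t. ln (g t)) has_real_derivative 0) (at 0)"
      using g0 by (auto intro!: derivative_eq_intros)
    then have "((\<lambda>t. (ln (g t) - ln (g 0)) / (t - 0)) \<longlongrightarrow> 0) (at 0)"
      by (simp add: has_field_derivative_iff)
    then have "((\<lambda>t. ln (g t) / t) \<longlongrightarrow> 0) (at 0)" by (simp add: g0)
    then show "((\<lambda>t. ln (g t) / t) \<longlongrightarrow> 0) (at_right 0)"
      by (rule tendsto_mono[OF at_le[OF subset_UNIV]])
  qed
  from tendsto_lowerbound[OF this ev] show ?thesis by simp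
qed

lemma score_eq:
  assumes p: "MLE_spec A y p" and \<eta>: "\<eta> \<in> row_space" and tangent: "(\<Sum>i\<in>UNIV. p$i * \<eta>$i) = 0"
  shows "(\<Sum>i\<in>UNIV. real (y$i) * \<eta>$i) = 0"
proof -
  have "- \<eta> \<in> row_space" by (intro subspace_neg subspace_row_space \<eta>)
  then have "(\<Sum>i\<in>UNIV. real (y$i) * (- \<eta>)$i) \<le> 0"
    by (rule score_le[OF p]) (simp add: sum_negf tangent)
  then show ?thesis using score_le[OF p \<eta> tangent] by (simp add: sum_negf)
qed

end

context relational_model
begin

section \<open>Geometry of the model at \<open>p0\<close>\<close>

lemma p0_pos: "p0$i > 0" and p0_sum: "(\<Sum>i\<in>UNIV. p0$i) = 1"
  using RM_pD[OF p0] by auto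

text \<open>In coordinates scaled by \<open>sqrt p0\<close> the limiting covariance of the counts is the projection
  orthogonal to \<open>sqrt p0\<close>. The space \<open>explained\<close> is spanned by \<open>sqrt p0\<close> and the tangent space of the
  model; this works whether or not the constant vector lies in the row space of \<open>A\<close>.\<close>

definition scale_sqrt :: "real^'i \<Rightarrow> real^'i" where
  "scale_sqrt x = (\<chi> i. sqrt (p0$i) * x$i)"

definition tangent :: "(real^'i) set" where
  "tangent = {\<eta> \<in> row_space. (\<Sum>i\<in>UNIV. p0$i * \<eta>$i) = 0}"

definition explained :: "(real^'i) set" where
  "explained = scale_sqrt ` span (insert 1 tangent)"

definition residual :: "(real^'i) set" where
  "residual = {v. \<forall>x\<in>explained. orthogonal x v}"

lemma linear_scale_sqrt: "linear scale_sqrt"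
  by (rule linearI) (simp_all add: scale_sqrt_def vec_eq_iff algebra_simps)

lemma inj_scale_sqrt: "inj scale_sqrt"
  using p0_pos by (auto simp: inj_def scale_sqrt_def vec_eq_iff less_imp_neq[symmetric])

lemma subspace_tangent: "subspace tangent"
proof (rule subspaceI)
  fix x y :: "real^'i" and c :: real
  show "0 \<in> tangent" using subspace_0[OF subspace_row_space] by (simp add: tangent_def)
  show "x + y \<in> tangent" if "x \<in> tangent" "y \<in> tangent"
    using that subspace_add[OF subspace_row_space] by (auto simp: tangent_def algebra_simps sum.distrib)
  show "c *\<^sub>R x \<in> tangent" if "x \<in> tangent"
    using that subspace_scale[OF subspace_row_space]
    by (auto simp: tangent_def mult.left_commute[of _ c] sum_distrib_left[symmetric])
qed

lemma span_tangent: "span tangent = tangent"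
  using subspace_tangent by (rule span_eq_iff[THEN iffD2])

lemma subspace_explained: "subspace explained"
  unfolding explained_def by (rule linear_subspace_image[OF linear_scale_sqrt subspace_span])

lemma subspace_residual: "subspace residual"
  unfolding residual_def by (rule subspace_orthogonal_to_vectors)

text \<open>The oblique projection along \<open>col_sums\<close>, which is possible because the
  \<open>p0\<close>-mean of \<open>col_sums\<close> is positive.\<close>

lemma project_tangent:
  assumes "\<eta> \<in> row_space"
  shows "\<eta> - ((\<Sum>i\<in>UNIV. p0$i * \<eta>$i) / (\<Sum>i\<in>UNIV. p0$i * col_sums$i)) *\<^sub>R col_sums \<in> tangent"
proof -
  let ?S = "\<Sum>i\<in>UNIV. p0$i * col_sums$i"
  define k where "k = (\<Sum>i\<in>UNIV. p0$i * \<eta>$i) / ?S"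
  have "?S > 0" by (rule sum_col_sums_pos[OF p0_pos])
  then have "(\<Sum>i\<in>UNIV. p0$i * \<eta>$i) = k * ?S" by (simp add: k_def)
  moreover have "(\<Sum>i\<in>UNIV. p0$i * (\<eta> - k *\<^sub>R col_sums)$i) = (\<Sum>i\<in>UNIV. p0$i * \<eta>$i) - k * ?S"
    by (simp add: algebra_simps sum_subtractf sum_distrib_left)
  moreover have "\<eta> - k *\<^sub>R col_sums \<in> row_space"
    by (intro subspace_diff subspace_scale subspace_row_space assms col_sums_in_row_space)
  ultimately show ?thesis by (simp add: tangent_def k_def)
qed

text \<open>Both \<open>row_space\<close> and the unscaled form of \<open>explained\<close> are
  \<open>tangent\<close> plus one vector of nonzero \<open>p0\<close>-mean, \<open>col_sums\<close>
  and \<open>1\<close> respectively. Their dimensions agree, hence so do those of their orthogonal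
  complements, and the complement of \<open>row_space\<close> is the kernel of
  \<open>A\<close>.\<close>

lemma dim_residual: "dim residual = kernel_dim A"
proof -
  have ker: "{x. A *v x = 0} = {y \<in> UNIV. \<forall>x\<in>row_space. orthogonal x y}"
  proof -
    have "A *v x = 0 \<longleftrightarrow> (\<forall>\<theta>. orthogonal (transpose A *v \<theta>) x)" for x
    proof -
      have "orthogonal (transpose A *v \<theta>) x \<longleftrightarrow> \<theta> \<bullet> (A *v x) = 0" for \<theta>
        by (simp add: orthogonal_def dot_lmul_matrix[symmetric])
      then show ?thesis by (metis inner_eq_zero_iff inner_zero_right)
    qed
    then show ?thesis by (auto simp: row_space_def)
  qed
  have "kernel_dim A + dim row_space = CARD('i)"
    unfolding kernel_dim_def ker
    using dim_subspace_orthogonal_to_vectors[OF subspace_row_space subspace_UNIV] by simp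
  moreover have "dim residual + dim explained = CARD('i)"
    using dim_subspace_orthogonal_to_vectors[OF subspace_explained subspace_UNIV]
    by (simp add: residual_def)
  moreover have "dim explained = dim row_space"
  proof -
    have "1 \<notin> tangent" using p0_sum by (auto simp: tangent_def)
    then have "dim (insert 1 tangent) = dim tangent + 1"
      by (subst dim_insert) (simp add: span_tangent)
    moreover have "dim (insert col_sums tangent) = dim tangent + 1"
    proof -
      have "col_sums \<notin> tangent"
        using sum_col_sums_pos[OF p0_pos] by (auto simp: tangent_def)
      then show ?thesis by (subst dim_insert) (simp add: span_tangent)
    qed
    moreover have "span (insert col_sums tangent) = row_space"
    proof
      show "span (insert col_sums tangent) \<subseteq> row_space"
        by (rule span_minimal[OF _ subspace_row_space]) (auto simp: tangent_def col_sums_in_row_space)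
      show "row_space \<subseteq> span (insert col_sums tangent)"
        unfolding subset_iff span_breakdown_eq span_tangent using project_tangent by blast
    qed
    moreover have "dim explained = dim (span (insert 1 tangent))"
      unfolding explained_def
      by (rule dim_image_eq[OF linear_scale_sqrt]) (rule inj_on_subset[OF inj_scale_sqrt], simp)
    ultimately show ?thesis by (metis dim_span)
  qed
  ultimately show ?thesis by simp
qed

lemma residual_sqrt_sum:
  assumes "v \<in> residual" shows "(\<Sum>i\<in>UNIV. v$i * sqrt (p0$i)) = 0"
proof -
  have "scale_sqrt 1 \<in> explained" unfolding explained_def by (intro imageI span_base) simp
  then show ?thesis
    using assms by (auto simp: residual_def orthogonal_def inner_vec_def scale_sqrt_def mult.commute)
qed

lemma residual_tangent_sum:
  assumes "v \<in> residual" "\<eta> \<in> tangent" shows "(\<Sum>i\<in>UNIV. v$i * (sqrt (p0$i) * \<eta>$i)) = 0"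
proof -
  have "scale_sqrt \<eta> \<in> explained" unfolding explained_def by (intro imageI span_base) (use assms in simp)
  then show ?thesis
    using assms by (auto simp: residual_def orthogonal_def inner_vec_def scale_sqrt_def mult.commute)
qed

lemma explainedE:
  assumes "x \<in> explained"
  obtains k \<eta> where "\<eta> \<in> tangent" "x = (\<chi> i. sqrt (p0$i) * (\<eta>$i + k))"
proof -
  obtain z where z: "z \<in> span (insert 1 tangent)" and x: "x = scale_sqrt z"
    using assms by (auto simp: explained_def)
  obtain k where "z - k *\<^sub>R 1 \<in> span tangent" using z by (auto simp: span_breakdown_eq)
  then have "z - k *\<^sub>R 1 \<in> tangent" by (simp add: span_tangent)
  then show thesis by (rule that[of _ k]) (simp add: x scale_sqrt_def)
qed

section \<open>Localisation and existence of a maximiser\<close>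

lemma norm_std_counts:
  assumes "N > 0"
  shows "(norm (std_counts p0 N y))\<^sup>2 = real N * (\<Sum>i\<in>UNIV. (real (y$i) / N - p0$i)\<^sup>2 / p0$i)"
proof -
  have "(norm (std_counts p0 N y))\<^sup>2 = (\<Sum>i\<in>UNIV. (std_counts p0 N y $ i)\<^sup>2)"
    by (simp only: power2_norm_eq_inner inner_vec_def) (simp add: power2_eq_square)
  also have "\<dots> = (\<Sum>i\<in>UNIV. real N * ((real (y$i) / N - p0$i)\<^sup>2 / p0$i))"
  proof (rule sum.cong[OF refl])
    fix i
    have "(std_counts p0 N y $ i)\<^sup>2 = (real (y$i) - real N * p0$i)\<^sup>2 / (real N * p0$i)"
      using p0_pos[of i] by (simp add: std_counts_def power_divide)
    also have "real (y$i) - real N * p0$i = real N * (real (y$i) / N - p0$i)"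
      using assms by (simp add: field_simps)
    finally show "(std_counts p0 N y $ i)\<^sup>2 = real N * ((real (y$i) / N - p0$i)\<^sup>2 / p0$i)"
      using assms by (simp add: power_mult_distrib power2_eq_square)
  qed
  finally show ?thesis by (simp add: sum_distrib_left)
qed

text \<open>\<open>Hellinger_bound\<close> with the empirical frequencies for \<open>q\<close> and
  \<open>p0\<close> for \<open>r\<close>. Asking only that \<open>p\<close> be at least as likely as
  \<open>p0\<close> makes the bound available before a maximiser is known to exist.\<close>

lemma likely_close:
  assumes N: "N > 0" and y: "y \<in> count_vecs N" and p: "p \<in> RM_p A" and le: "loglik y p0 \<le> loglik y p"
  shows "\<bar>sqrt N * (real (y$i) / N - p$i)\<bar> \<le> 2 * norm (std_counts p0 N y)"
proof -
  have lik: "loglik y r = N * (\<Sum>i\<in>UNIV. real (y$i) / N * ln (r$i))" for r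
    using N by (simp add: loglik_def sum_distrib_left)
  have "(real (y$i) / N - p$i)\<^sup>2 \<le> 4 * (\<Sum>i\<in>UNIV. (real (y$i) / N - p0$i)\<^sup>2 / p0$i)"
  proof (rule Hellinger_bound)
    have "(\<Sum>i\<in>UNIV. real (y$i)) = real N" using y by (simp add: count_vecs_def flip: of_nat_sum)
    then show "(\<Sum>i\<in>UNIV. real (y$i) / N) = 1" using N by (simp add: sum_divide_distrib[symmetric])
    show "(\<Sum>i\<in>UNIV. real (y$i) / N * ln (p0$i)) \<le> (\<Sum>i\<in>UNIV. real (y$i) / N * ln (p$i))"
      using le N unfolding lik by simp
  qed (use RM_pD[OF p] p0_pos p0_sum in auto)
  then have "N * (real (y$i) / N - p$i)\<^sup>2 \<le> N * (4 * (\<Sum>i\<in>UNIV. (real (y$i) / N - p0$i)\<^sup>2 / p0$i))"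
    by (rule mult_left_mono) simp
  also have "\<dots> = 4 * (norm (std_counts p0 N y))\<^sup>2" by (simp add: norm_std_counts[OF N])
  finally have "(sqrt N * (real (y$i) / N - p$i))\<^sup>2 \<le> (2 * norm (std_counts p0 N y))\<^sup>2"
    by (simp add: power_mult_distrib)
  then show ?thesis using abs_le_square_iff[of "sqrt N * (real (y$i) / N - p$i)" "2 * norm (std_counts p0 N y)"] by simp
qed

lemma std_counts_nth:
  assumes N: "N > 0"
  shows "std_counts p0 N y $ i = sqrt N * (real (y$i) / N - p0$i) / sqrt (p0$i)"
proof -
  define s where "s = sqrt (real N)"
  have s: "real N = s * s" "s > 0" using N by (auto simp: s_def)
  then have "sqrt (s * s * p0$i) = s * sqrt (p0$i)" by (simp add: real_sqrt_mult)
  then have "std_counts p0 N y $ i = (real (y$i) - s * s * p0$i) / (s * sqrt (p0$i))"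
    by (simp add: std_counts_def s(1))
  also have "\<dots> = s * (real (y$i) / (s * s) - p0$i) / sqrt (p0$i)"
    using s(2) p0_pos[of i] by (simp add: field_simps)
  finally show ?thesis by (simp add: s(1)[symmetric]) (simp add: s_def)
qed

lemma counts_close:
  assumes N: "N > 0"
  shows "\<bar>sqrt N * (real (y$i) / N - p0$i)\<bar> \<le> norm (std_counts p0 N y)"
proof -
  have "p0$i \<le> 1" using member_le_sum[of i UNIV "\<lambda>i. p0$i"] p0_pos p0_sum by (auto simp: less_imp_le)
  have "sqrt N * (real (y$i) / N - p0$i) = sqrt (p0$i) * std_counts p0 N y $ i"
    using p0_pos[of i] by (simp add: std_counts_nth[OF N])
  then have "\<bar>sqrt N * (real (y$i) / N - p0$i)\<bar> = sqrt (p0$i) * \<bar>std_counts p0 N y $ i\<bar>"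
    using p0_pos[of i] by (simp add: abs_mult)
  also have "\<dots> \<le> 1 * norm (std_counts p0 N y)"
    using \<open>p0$i \<le> 1\<close> p0_pos[of i] by (intro mult_mono component_le_norm_cart) auto
  finally show ?thesis by simp
qed

text \<open>The model is not compact, but every point at least as likely as \<open>p0\<close> lies
  within \<open>3 * norm W / sqrt N\<close> of it in each coordinate: 2 from
  \<open>likely_close\<close> and 1 from \<open>counts_close\<close>. The search can thus be
  restricted to the compact part \<open>C\<close>.\<close>

lemma MLE_exists:
  assumes N: "N > 0" and y: "y \<in> count_vecs N"
    and small: "\<And>i. 3 * norm (std_counts p0 N y) \<le> sqrt N * (p0$i / 2)"
  shows "y \<in> MLE_exists_set A"
proof -
  define C where "C = {p \<in> RM_p A. \<forall>i. p0$i / 2 \<le> p$i}"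
  \<comment> \<open>On \<open>C\<close> the \<open>max\<close> changes nothing; it makes the
    logarithm continuous on the whole space, so that the row-space condition becomes closed.\<close>
  have C_eq: "C = {p. (\<forall>i. p0$i / 2 \<le> p$i) \<and> (\<Sum>i\<in>UNIV. p$i) = 1 \<and> (\<chi> i. ln (max (p0$i / 2) (p$i))) \<in> row_space}"
  proof -
    have "max (p0$i / 2) (p$i) = p$i" if "\<forall>i. p0$i / 2 \<le> p$i" for p :: "real^'i" and i
      using that by (auto simp: max_def)
    moreover have "p$i > 0" if "\<forall>i. p0$i / 2 \<le> p$i" for p :: "real^'i" and i
      using that[rule_format, of i] p0_pos[of i] by linarith
    ultimately show ?thesis by (auto simp: C_def RM_p_iff)
  qed
  have "closed C"
  proof -
    have "closed {p. (\<chi> i. ln (max (p0$i / 2) (p$i))) \<in> row_space}"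
    proof -
      have "max (p0$i / 2) x \<noteq> 0" for i and x :: real using p0_pos[of i] by (auto simp: max_def)
      then have "continuous_on UNIV (\<lambda>p. \<chi> i. ln (max (p0$i / 2) (p$i)))"
        by (intro continuous_intros) auto
      from closed_vimage[OF closed_subspace[OF subspace_row_space] this]
      show ?thesis by (simp only: vimage_def)
    qed
    note closed_row = this
    show ?thesis
      unfolding C_eq by (intro closed_row closed_Collect_conj closed_Collect_all closed_Collect_le closed_Collect_eq continuous_intros)
  qed
  moreover have "bounded C"
  proof (rule bounded_subset)
    show "C \<subseteq> cball 0 1"
    proof
      fix p assume "p \<in> C"
      then have p: "p \<in> RM_p A" by (simp add: C_def)
      have "norm p \<le> (\<Sum>i\<in>UNIV. \<bar>p$i\<bar>)" by (rule norm_le_l1_cart)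
      also have "\<dots> = 1" using RM_pD[OF p] by (simp add: less_imp_le)
      finally show "p \<in> cball 0 1" by simp
    qed
  qed simp
  ultimately have "compact C" by (simp add: compact_eq_bounded_closed)
  moreover have p0C: "p0 \<in> C" using p0 p0_pos by (auto simp: C_def less_imp_le)
  moreover have "continuous_on C (loglik y)"
    unfolding loglik_def using RM_pD(1) by (intro continuous_intros) (auto simp: C_def less_imp_neq[symmetric])
  ultimately obtain m where m: "m \<in> C" "\<And>p. p \<in> C \<Longrightarrow> loglik y p \<le> loglik y m"
    using continuous_attains_sup[of C "loglik y"] by blast
  have "loglik y p \<le> loglik y m" if p: "p \<in> RM_p A" for p
  proof (cases "loglik y p0 \<le> loglik y p")
    case True
    have "p0$i / 2 \<le> p$i" for i
    proof -
      have "sqrt N * (p0$i - p$i) = sqrt N * (real (y$i) / N - p$i) - sqrt N * (real (y$i) / N - p0$i)"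
        by (simp add: algebra_simps)
      also have "\<dots> \<le> 3 * norm (std_counts p0 N y)"
        using likely_close[OF N y p True, of i] counts_close[OF N, of y i] by linarith
      also have "\<dots> \<le> sqrt N * (p0$i / 2)" by (rule small)
      finally show ?thesis using N by simp
    qed
    then show ?thesis using p by (intro m) (auto simp: C_def)
  next
    case False
    then show ?thesis using m(2)[OF p0C] by simp
  qed
  then show ?thesis using m(1) by (auto simp: MLE_exists_set_def C_def)
qed

end

section \<open>Uniform asymptotics of the statistics\<close>

lemma tendsto_bounded_mult_null:
  fixes f g :: "'a \<Rightarrow> real"
  assumes "(f \<longlongrightarrow> 0) F" "\<forall>\<^sub>F x in F. \<bar>g x\<bar> \<le> B"
  shows "((\<lambda>x. g x * f x) \<longlongrightarrow> 0) F"
  by (rule lim_null_mult_left_bounded[of _ B]) (use assms in auto)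

text \<open>At \<open>0\<close> both remainders have the value \<open>0\<close> through division by zero, which makes them continuous there.\<close>

definition ln_rem :: "real \<Rightarrow> real" where
  "ln_rem t = (ln (1 + t) - t) / t"

definition xlogx_rem :: "real \<Rightarrow> real" where
  "xlogx_rem t = (2 * ((1 + t) * ln (1 + t) - t) - t\<^sup>2) / t\<^sup>2"

lemma ln_eq_rem: "ln (1 + t) = t + t * ln_rem t"
  by (simp add: ln_rem_def)

lemma xlogx_eq_rem: "2 * ((1 + t) * ln (1 + t) - t) = t\<^sup>2 + t\<^sup>2 * xlogx_rem t"
  by (simp add: xlogx_rem_def)

lemma tendsto_ln_rem:
  assumes "(f \<longlongrightarrow> 0) F" shows "((\<lambda>x. ln_rem (f x)) \<longlongrightarrow> 0) F"
proof -
  have "(ln_rem \<longlongrightarrow> 0) (at 0)" unfolding ln_rem_def by real_asymp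
  then have "isCont ln_rem 0" by (simp add: isCont_def ln_rem_def)
  from isCont_tendsto_compose[OF this assms] show ?thesis by (simp add: ln_rem_def)
qed

lemma tendsto_xlogx_rem:
  assumes "(f \<longlongrightarrow> 0) F" shows "((\<lambda>x. xlogx_rem (f x)) \<longlongrightarrow> 0) F"
proof -
  have "(xlogx_rem \<longlongrightarrow> 0) (at 0)" unfolding xlogx_rem_def by real_asymp
  then have "isCont xlogx_rem 0" by (simp add: isCont_def xlogx_rem_def)
  from isCont_tendsto_compose[OF this assms] show ?thesis by (simp add: xlogx_rem_def)
qed

text \<open>The general filter is the point: on pairs of a sample size and a count vector, one limit
  covers all bounded data at once.\<close>

locale MLE_limit = relational_model A p0
  for A :: "real^'i::finite^'j::finite" and p0 :: "real^'i" +
  fixes F :: "'a filter" and N :: "'a \<Rightarrow> nat" and y :: "'a \<Rightarrow> nat^'i" and ph :: "'a \<Rightarrow> real^'i" and M :: real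
  assumes N: "filterlim N at_top F"
    and y: "\<forall>\<^sub>F x in F. y x \<in> count_vecs (N x)"
    and bdd: "\<forall>\<^sub>F x in F. norm (std_counts p0 (N x) (y x)) \<le> M"
    and ph: "\<forall>\<^sub>F x in F. MLE_spec A (y x) (ph x)"
begin

abbreviation "W x \<equiv> std_counts p0 (N x) (y x)"

definition "n x = sqrt (real (N x))"
text \<open>At scale \<open>sqrt N\<close>: \<open>e\<close> is observed minus fitted,
  \<open>d\<close> is fitted minus true, \<open>h\<close> is \<open>d\<close> on the log scale. The
  sum \<open>e + d\<close> is \<open>W\<close> before division by \<open>sqrt p0\<close>.\<close>

definition "e i x = n x * (real (y x $ i) / N x - ph x $ i)"
definition "d i x = n x * (ph x $ i - p0 $ i)"
definition "h i x = n x * (ln (ph x $ i) - ln (p0 $ i))"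

definition "good x \<longleftrightarrow> N x > 0 \<and> y x \<in> count_vecs (N x) \<and> norm (W x) \<le> M \<and> MLE_spec A (y x) (ph x)"

lemma ev_good: "\<forall>\<^sub>F x in F. good x"
proof -
  have "\<forall>\<^sub>F x in F. N x > 0"
    by (rule eventually_compose_filterlim[OF eventually_gt_at_top N])
  then show ?thesis
    using y bdd ph by eventually_elim (simp add: good_def)
qed

lemma tendsto_good_cong:
  assumes "\<And>x. good x \<Longrightarrow> f x = g x" "(g \<longlongrightarrow> l) F"
  shows "(f \<longlongrightarrow> l) F"
  by (rule Lim_transform_eventually[OF assms(2)])
    (use ev_good in \<open>eventually_elim, simp add: assms(1)\<close>)

lemma good_n: "good x \<Longrightarrow> n x > 0" "n x * n x = real (N x)"
  by (auto simp: good_def n_def)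

lemma good_ph: "good x \<Longrightarrow> ph x $ i > 0" "good x \<Longrightarrow> (\<Sum>i\<in>UNIV. ph x $ i) = 1"
  "good x \<Longrightarrow> ph x \<in> RM_p A"
  using RM_pD by (auto simp: good_def MLE_spec_def)

lemma sum_q: "good x \<Longrightarrow> (\<Sum>i\<in>UNIV. real (y x $ i) / N x) = 1"
proof -
  assume g: "good x"
  then have "(\<Sum>i\<in>UNIV. real (y x $ i)) = real (N x)"
    by (simp add: good_def count_vecs_def flip: of_nat_sum)
  then show ?thesis using g by (simp add: sum_divide_distrib[symmetric] good_def)
qed

lemma e_bound: "good x \<Longrightarrow> \<bar>e i x\<bar> \<le> 2 * M"
  using likely_close[of "N x" "y x" "ph x" i] p0
  by (auto simp: good_def e_def n_def MLE_spec_def)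

lemma d_bound: "good x \<Longrightarrow> \<bar>d i x\<bar> \<le> 3 * M"
proof -
  assume g: "good x"
  have "d i x = n x * (real (y x $ i) / N x - p0 $ i) - e i x"
    by (simp add: d_def e_def algebra_simps)
  moreover have "\<bar>n x * (real (y x $ i) / N x - p0 $ i)\<bar> \<le> M"
    using counts_close[of "N x" "y x" i] g by (auto simp: good_def n_def)
  ultimately show ?thesis using e_bound[OF g, of i] by linarith
qed

lemma sum_e: "good x \<Longrightarrow> (\<Sum>i\<in>UNIV. e i x) = 0"
  by (simp add: e_def sum_distrib_left[symmetric] sum_subtractf sum_q good_ph)

lemma sum_d: "good x \<Longrightarrow> (\<Sum>i\<in>UNIV. d i x) = 0"
  by (simp add: d_def sum_distrib_left[symmetric] sum_subtractf good_ph p0_sum)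

lemma inv_n: "((\<lambda>x. inverse (n x)) \<longlongrightarrow> 0) F"
  unfolding n_def
  by (intro tendsto_inverse_0_at_top filterlim_compose[OF sqrt_at_top]
      filterlim_compose[OF filterlim_real_sequentially] N)

lemma bounded_null:
  assumes "(f \<longlongrightarrow> 0) F"
  shows "((\<lambda>x. e i x * f x) \<longlongrightarrow> 0) F" "((\<lambda>x. d i x * f x) \<longlongrightarrow> 0) F"
    "((\<lambda>x. (e i x)\<^sup>2 * f x) \<longlongrightarrow> 0) F" "((\<lambda>x. (b \<bullet> W x) * f x) \<longlongrightarrow> 0) F"
proof -
  show "((\<lambda>x. e i x * f x) \<longlongrightarrow> 0) F"
    by (rule tendsto_bounded_mult_null[OF assms]) (rule eventually_mono[OF ev_good e_bound])
  show "((\<lambda>x. d i x * f x) \<longlongrightarrow> 0) F"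
    by (rule tendsto_bounded_mult_null[OF assms]) (rule eventually_mono[OF ev_good d_bound])
  have "\<bar>(e i x)\<^sup>2\<bar> \<le> (2 * M)\<^sup>2" if "good x" for x
    using power_mono[OF e_bound[OF that, of i], of 2] by simp
  then show "((\<lambda>x. (e i x)\<^sup>2 * f x) \<longlongrightarrow> 0) F"
    by (intro tendsto_bounded_mult_null[OF assms] eventually_mono[OF ev_good])
  have "\<bar>b \<bullet> W x\<bar> \<le> norm b * M" if "good x" for x
  proof -
    have "\<bar>b \<bullet> W x\<bar> \<le> norm b * norm (W x)" by (rule Cauchy_Schwarz_ineq2)
    also have "\<dots> \<le> norm b * M" using that by (intro mult_left_mono) (auto simp: good_def)
    finally show ?thesis .
  qed
  then show "((\<lambda>x. (b \<bullet> W x) * f x) \<longlongrightarrow> 0) F"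
    by (intro tendsto_bounded_mult_null[OF assms] eventually_mono[OF ev_good])
qed

lemma ph_lim: "((\<lambda>x. ph x $ i) \<longlongrightarrow> p0 $ i) F"
proof (rule LIM_zero_cancel, rule tendsto_good_cong)
  show "((\<lambda>x. d i x * inverse (n x)) \<longlongrightarrow> 0) F" by (rule bounded_null(2)[OF inv_n])
  show "ph x $ i - p0 $ i = d i x * inverse (n x)" if "good x" for x
    using good_n(1)[OF that] by (simp add: d_def)
qed

lemma log_linearised: "((\<lambda>x. h i x - d i x / p0 $ i) \<longlongrightarrow> 0) F"
proof (rule tendsto_good_cong)
  have "((\<lambda>x. (ph x $ i - p0 $ i) / p0 $ i) \<longlongrightarrow> (p0 $ i - p0 $ i) / p0 $ i) F"
    by (intro tendsto_intros ph_lim) (use p0_pos[of i] in simp)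
  then have "((\<lambda>x. ln_rem ((ph x $ i - p0 $ i) / p0 $ i) / p0 $ i) \<longlongrightarrow> 0 / p0 $ i) F"
    by (intro tendsto_divide tendsto_ln_rem tendsto_const) (use p0_pos[of i] in auto)
  then show "((\<lambda>x. d i x * (ln_rem ((ph x $ i - p0 $ i) / p0 $ i) / p0 $ i)) \<longlongrightarrow> 0) F"
    by (intro bounded_null(2)) simp
  show "h i x - d i x / p0 $ i = d i x * (ln_rem ((ph x $ i - p0 $ i) / p0 $ i) / p0 $ i)" if "good x" for x
  proof -
    define t where "t = (ph x $ i - p0 $ i) / p0 $ i"
    have "1 + t = ph x $ i / p0 $ i" using p0_pos[of i] by (simp add: t_def field_simps)
    then have "ln (ph x $ i) - ln (p0 $ i) = t + t * ln_rem t"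
      using ln_eq_rem[of t] good_ph(1)[OF that, of i] p0_pos[of i] by (simp add: ln_div)
    moreover have "n x * t = d i x / p0 $ i" by (simp add: t_def d_def)
    ultimately have "h i x = d i x / p0 $ i + d i x / p0 $ i * ln_rem t"
      by (simp add: h_def distrib_left mult.assoc[symmetric])
    then show ?thesis by (simp add: t_def)
  qed
qed

text \<open>The \<open>d i x\<close> sum to zero and \<open>h\<close> is asymptotically
  \<open>d / p0\<close>: the log deviation of the fit becomes tangent at \<open>p0\<close>.\<close>

lemma log_mass_null: "((\<lambda>x. \<Sum>i\<in>UNIV. p0 $ i * h i x) \<longlongrightarrow> 0) F"
proof (rule tendsto_good_cong)
  show "((\<lambda>x. \<Sum>i\<in>UNIV. p0 $ i * (h i x - d i x / p0 $ i)) \<longlongrightarrow> 0) F"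
    by (intro tendsto_null_sum tendsto_mult_right_zero log_linearised)
  show "(\<Sum>i\<in>UNIV. p0 $ i * h i x) = (\<Sum>i\<in>UNIV. p0 $ i * (h i x - d i x / p0 $ i))" if "good x" for x
  proof -
    have "(\<Sum>i\<in>UNIV. p0 $ i * (h i x - d i x / p0 $ i)) = (\<Sum>i\<in>UNIV. p0 $ i * h i x - d i x)"
      using p0_pos by (intro sum.cong) (auto simp: right_diff_distrib less_imp_neq[symmetric])
    then show ?thesis using sum_d[OF that] by (simp add: sum_subtractf)
  qed
qed

text \<open>The log ratio of fit to truth lies in \<open>row_space\<close>, and so is tangent up to
  a multiple of \<open>col_sums\<close>. The vector \<open>v\<close> annihilates the tangent part,
  the multiple vanishes by \<open>log_mass_null\<close>, and linearisation replaces \<open>h\<close>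
  by \<open>d\<close>.\<close>

lemma residual_d_null:
  assumes v: "v \<in> residual"
  shows "((\<lambda>x. \<Sum>i\<in>UNIV. v $ i * (d i x / sqrt (p0 $ i))) \<longlongrightarrow> 0) F"
proof (rule tendsto_good_cong)
  let ?S = "\<Sum>i\<in>UNIV. p0 $ i * col_sums $ i" and ?c = "\<Sum>i\<in>UNIV. v $ i * (sqrt (p0 $ i) * col_sums $ i)"
  have "((\<lambda>x. (\<Sum>i\<in>UNIV. p0 $ i * h i x) / ?S * ?c -
      (\<Sum>i\<in>UNIV. v $ i * sqrt (p0 $ i) * (h i x - d i x / p0 $ i))) \<longlongrightarrow> 0 / ?S * ?c - 0) F"
    using sum_col_sums_pos[OF p0_pos]
    by (intro tendsto_diff tendsto_mult tendsto_divide log_mass_null tendsto_const tendsto_null_sum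
        tendsto_mult_right_zero log_linearised) simp
  then show "((\<lambda>x. (\<Sum>i\<in>UNIV. p0 $ i * h i x) / ?S * ?c -
      (\<Sum>i\<in>UNIV. v $ i * sqrt (p0 $ i) * (h i x - d i x / p0 $ i))) \<longlongrightarrow> 0) F" by simp
  show "(\<Sum>i\<in>UNIV. v $ i * (d i x / sqrt (p0 $ i))) = (\<Sum>i\<in>UNIV. p0 $ i * h i x) / ?S * ?c -
      (\<Sum>i\<in>UNIV. v $ i * sqrt (p0 $ i) * (h i x - d i x / p0 $ i))" if g: "good x" for x
  proof -
    define \<eta> where "\<eta> = (\<chi> i. ln (ph x $ i)) - (\<chi> i. ln (p0 $ i))"
    define k where "k = (\<Sum>i\<in>UNIV. p0 $ i * \<eta> $ i) / ?S"
    have h: "h i x = n x * \<eta> $ i" for i by (simp add: h_def \<eta>_def)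
    have "\<eta> \<in> row_space"
      unfolding \<eta>_def by (intro subspace_diff subspace_row_space RM_pD(3) p0 good_ph(3)[OF g])
    then have "\<eta> - k *\<^sub>R col_sums \<in> tangent" unfolding k_def by (rule project_tangent)
    from residual_tangent_sum[OF v this]
    have "(\<Sum>i\<in>UNIV. v $ i * (sqrt (p0 $ i) * \<eta> $ i)) = k * ?c"
      by (simp add: algebra_simps sum_subtractf sum_distrib_left)
    moreover have "(\<Sum>i\<in>UNIV. v $ i * sqrt (p0 $ i) * h i x) = n x * (\<Sum>i\<in>UNIV. v $ i * (sqrt (p0 $ i) * \<eta> $ i))"
      by (simp add: h sum_distrib_left mult_ac)
    ultimately have "(\<Sum>i\<in>UNIV. v $ i * sqrt (p0 $ i) * h i x) = n x * (k * ?c)" by simp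
    also have "\<dots> = (\<Sum>i\<in>UNIV. p0 $ i * h i x) / ?S * ?c"
      by (simp add: k_def h mult.left_commute[of _ "n x"] sum_distrib_left[symmetric])
    finally have "(\<Sum>i\<in>UNIV. v $ i * sqrt (p0 $ i) * h i x) = \<dots>" .
    moreover have "v $ i * (d i x / sqrt (p0 $ i)) = v $ i * sqrt (p0 $ i) * h i x - v $ i * sqrt (p0 $ i) * (h i x - d i x / p0 $ i)" for i
      using p0_pos[of i] by (simp add: right_diff_distrib real_div_sqrt field_simps)
    ultimately show ?thesis by (simp add: sum_subtractf)
  qed
qed

text \<open>The vector \<eta> is tangent at \<open>p0\<close>, whereas the score equation wants
  tangency at the fit. The correction \<kappa> along \<open>col_sums\<close> tends to 0 with the
  fit; the constant part \<open>k\<close> drops out because \<open>e\<close> sums to zero.\<close>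

lemma explained_e_null:
  assumes c: "c \<in> explained"
  shows "((\<lambda>x. \<Sum>i\<in>UNIV. c $ i * (e i x / sqrt (p0 $ i))) \<longlongrightarrow> 0) F"
proof -
  obtain k \<eta> where \<eta>: "\<eta> \<in> tangent" and c: "c = (\<chi> i. sqrt (p0 $ i) * (\<eta> $ i + k))"
    using explainedE[OF c] by metis
  have \<eta>R: "\<eta> \<in> row_space" and \<eta>0: "(\<Sum>i\<in>UNIV. p0 $ i * \<eta> $ i) = 0"
    using \<eta> by (auto simp: tangent_def)
  define \<kappa> where "\<kappa> x = (\<Sum>i\<in>UNIV. ph x $ i * \<eta> $ i) / (\<Sum>i\<in>UNIV. ph x $ i * col_sums $ i)" for x
  have "(\<kappa> \<longlongrightarrow> (\<Sum>i\<in>UNIV. p0 $ i * \<eta> $ i) / (\<Sum>i\<in>UNIV. p0 $ i * col_sums $ i)) F"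
    unfolding \<kappa>_def using sum_col_sums_pos[OF p0_pos] by (intro tendsto_intros ph_lim) simp
  then have \<kappa>: "(\<kappa> \<longlongrightarrow> 0) F" by (simp add: \<eta>0)
  show ?thesis
  proof (rule tendsto_good_cong)
    have "((\<lambda>x. \<Sum>i\<in>UNIV. e i x * (\<kappa> x * col_sums $ i)) \<longlongrightarrow> 0) F"
      by (intro tendsto_null_sum bounded_null(1) tendsto_mult_left_zero \<kappa>)
    then show "((\<lambda>x. \<Sum>i\<in>UNIV. e i x * (\<kappa> x * col_sums $ i)) \<longlongrightarrow> 0) F" .
    show "(\<Sum>i\<in>UNIV. c $ i * (e i x / sqrt (p0 $ i))) = (\<Sum>i\<in>UNIV. e i x * (\<kappa> x * col_sums $ i))"
      if g: "good x" for x
    proof -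
      define \<zeta> where "\<zeta> = \<eta> - \<kappa> x *\<^sub>R col_sums"
      have "\<zeta> \<in> row_space"
        unfolding \<zeta>_def by (intro subspace_diff subspace_scale subspace_row_space \<eta>R col_sums_in_row_space)
      moreover have ph0: "(\<Sum>i\<in>UNIV. ph x $ i * \<zeta> $ i) = 0"
      proof -
        have "(\<Sum>i\<in>UNIV. ph x $ i * \<eta> $ i) = \<kappa> x * (\<Sum>i\<in>UNIV. ph x $ i * col_sums $ i)"
          using sum_col_sums_pos[OF good_ph(1)[OF g]] by (simp add: \<kappa>_def)
        then show ?thesis by (simp add: \<zeta>_def algebra_simps sum_subtractf sum_distrib_left)
      qed
      moreover have "MLE_spec A (y x) (ph x)" using g by (simp add: good_def)
      ultimately have y0: "(\<Sum>i\<in>UNIV. real (y x $ i) * \<zeta> $ i) = 0"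
        by (intro score_eq) auto
      have "(\<Sum>i\<in>UNIV. e i x * \<zeta> $ i) =
          n x * ((\<Sum>i\<in>UNIV. real (y x $ i) * \<zeta> $ i) / N x - (\<Sum>i\<in>UNIV. ph x $ i * \<zeta> $ i))"
        by (simp add: e_def algebra_simps sum_subtractf sum_distrib_left sum_divide_distrib)
      then have "(\<Sum>i\<in>UNIV. e i x * \<eta> $ i) = (\<Sum>i\<in>UNIV. e i x * (\<kappa> x * col_sums $ i))"
        by (simp add: ph0 y0) (simp add: \<zeta>_def right_diff_distrib sum_subtractf)
      moreover have "(\<Sum>i\<in>UNIV. c $ i * (e i x / sqrt (p0 $ i))) = (\<Sum>i\<in>UNIV. e i x * \<eta> $ i + k * e i x)"
        using p0_pos by (intro sum.cong) (auto simp: c algebra_simps less_imp_neq[symmetric])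
      ultimately show ?thesis using sum_e[OF g] by (simp add: sum.distrib sum_distrib_left[symmetric])
    qed
  qed
qed

definition "u x = (\<chi> i. e i x / sqrt (p0 $ i))"

lemma norm_u: "(norm (u x))\<^sup>2 = (\<Sum>i\<in>UNIV. (e i x)\<^sup>2 / p0 $ i)"
proof -
  have "(norm (u x))\<^sup>2 = (\<Sum>i\<in>UNIV. (u x $ i)\<^sup>2)"
    by (simp only: power2_norm_eq_inner inner_vec_def) (simp add: power2_eq_square)
  also have "\<dots> = (\<Sum>i\<in>UNIV. (e i x)\<^sup>2 / p0 $ i)"
    using p0_pos by (intro sum.cong) (auto simp: u_def power_divide less_imp_le)
  finally show ?thesis .
qed

text \<open>Parseval in the joint basis of \<open>C\<close> for \<open>explained\<close> and
  \<open>B\<close> for \<open>residual\<close>: the \<open>C\<close>-coordinates of \<open>u\<close>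
  vanish in the limit, and its \<open>B\<close>-coordinates differ from those of
  \<open>W = u + D\<close> by those of \<open>D\<close>, which vanish as well.\<close>

lemma norm_u_lim:
  assumes B: "orthonormal B" "span B = residual"
  shows "((\<lambda>x. (norm (u x))\<^sup>2 - (\<Sum>b\<in>B. (b \<bullet> W x)\<^sup>2)) \<longlongrightarrow> 0) F"
proof -
  obtain C where C: "orthonormal C" "C \<subseteq> explained" "span C = explained"
    using orthonormal_basis_obtain[OF subspace_explained] by metis
  have BR: "b \<in> residual" if "b \<in> B" for b using that B(2) span_base by blast
  define D where "D x = (\<chi> i. d i x / sqrt (p0 $ i))" for x
  have W: "W x = u x + D x" if "good x" for x
  proof -
    have "N x > 0" using that by (simp add: good_def)
    then show ?thesis
      by (simp add: vec_eq_iff std_counts_nth u_def D_def e_def d_def n_def algebra_simps diff_divide_distrib add_divide_distrib)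
  qed
  have norm2: "(norm w)\<^sup>2 = (\<Sum>c\<in>C. (c \<bullet> w)\<^sup>2) + (\<Sum>b\<in>B. (b \<bullet> w)\<^sup>2)" for w
  proof -
    obtain a v where a: "a \<in> span explained" and v: "\<And>z. z \<in> span explained \<Longrightarrow> orthogonal v z" and w: "w = a + v"
      using orthogonal_subspace_decomp_exists[of explained w] by metis
    have vR: "v \<in> residual"
      using v span_base by (auto simp: residual_def orthogonal_commute)
    have aE: "a \<in> explained" using a span_eq_iff[THEN iffD2, OF subspace_explained] by simp
    have "orthogonal a v" using v[OF a] by (simp add: orthogonal_commute)
    then have "(norm w)\<^sup>2 = (norm a)\<^sup>2 + (norm v)\<^sup>2" unfolding w by (rule norm_add_Pythagorean)
    also have "(norm a)\<^sup>2 = (\<Sum>c\<in>C. (c \<bullet> a)\<^sup>2)"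
      by (rule orthonormal_Parseval) (use C aE in auto)
    also have "\<dots> = (\<Sum>c\<in>C. (c \<bullet> w)\<^sup>2)"
    proof (rule sum.cong[OF refl])
      fix c assume "c \<in> C"
      then have "c \<bullet> v = 0" using C(2) vR by (auto simp: residual_def orthogonal_def)
      then show "(c \<bullet> a)\<^sup>2 = (c \<bullet> w)\<^sup>2" by (simp add: w inner_add_right)
    qed
    also have "(norm v)\<^sup>2 = (\<Sum>b\<in>B. (b \<bullet> v)\<^sup>2)"
      by (rule orthonormal_Parseval) (use B vR in auto)
    also have "\<dots> = (\<Sum>b\<in>B. (b \<bullet> w)\<^sup>2)"
    proof (rule sum.cong[OF refl])
      fix b assume "b \<in> B"
      then have "orthogonal a b" using BR aE by (auto simp: residual_def)
      then have "b \<bullet> a = 0" by (simp add: orthogonal_def inner_commute)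
      then show "(b \<bullet> v)\<^sup>2 = (b \<bullet> w)\<^sup>2" by (simp add: w inner_add_right)
    qed
    finally show ?thesis .
  qed
  have cu: "((\<lambda>x. c \<bullet> u x) \<longlongrightarrow> 0) F" if "c \<in> C" for c
    using explained_e_null[of c] that C(2) by (auto simp: u_def inner_vec_def)
  have bD: "((\<lambda>x. b \<bullet> D x) \<longlongrightarrow> 0) F" if "b \<in> B" for b
    using residual_d_null[OF BR[OF that]] by (simp add: D_def inner_vec_def)
  show ?thesis
  proof (rule tendsto_good_cong)
    have "((\<lambda>x. (\<Sum>c\<in>C. (c \<bullet> u x)\<^sup>2) + (\<Sum>b\<in>B. (b \<bullet> D x)\<^sup>2 - 2 * ((b \<bullet> W x) * (b \<bullet> D x))))
      \<longlongrightarrow> (\<Sum>c\<in>C. 0\<^sup>2) + (\<Sum>b\<in>B. 0\<^sup>2 - 2 * 0)) F"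
      by (intro tendsto_intros cu bD bounded_null(4))
    then show "((\<lambda>x. (\<Sum>c\<in>C. (c \<bullet> u x)\<^sup>2) + (\<Sum>b\<in>B. (b \<bullet> D x)\<^sup>2 - 2 * ((b \<bullet> W x) * (b \<bullet> D x))))
      \<longlongrightarrow> 0) F" by simp
    show "(norm (u x))\<^sup>2 - (\<Sum>b\<in>B. (b \<bullet> W x)\<^sup>2) =
      (\<Sum>c\<in>C. (c \<bullet> u x)\<^sup>2) + (\<Sum>b\<in>B. (b \<bullet> D x)\<^sup>2 - 2 * ((b \<bullet> W x) * (b \<bullet> D x)))" if "good x" for x
    proof -
      have "(b \<bullet> u x)\<^sup>2 - (b \<bullet> W x)\<^sup>2 = (b \<bullet> D x)\<^sup>2 - 2 * ((b \<bullet> W x) * (b \<bullet> D x))" for b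
        by (simp add: W[OF that] inner_add_right power2_eq_square algebra_simps)
      then show ?thesis
        by (simp only: norm2[of "u x"]) (simp add: sum_subtractf[symmetric])
    qed
  qed
qed

text \<open>Here \<open>t\<close> is the relative deviation of a count from its fitted value; each
  statistic is a sum over the cells of the fitted count times a function of
  \<open>t\<close>.\<close>

lemma term_eq:
  assumes g: "good x"
  defines "t \<equiv> \<lambda>i. (real (y x $ i) / N x - ph x $ i) / ph x $ i"
  shows "real (y x $ i) - real (N x) * ph x $ i = real (N x) * ph x $ i * t i"
    "real (N x) * ph x $ i * (t i)\<^sup>2 = (e i x)\<^sup>2 / ph x $ i"
    "real (y x $ i) / (real (N x) * ph x $ i) = 1 + t i"
    "real (y x $ i) = real (N x) * ph x $ i * (1 + t i)"
proof -
  have pos: "ph x $ i > 0" "real (N x) > 0" using good_ph(1)[OF g, of i] g by (auto simp: good_def)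
  then show "real (y x $ i) - real (N x) * ph x $ i = real (N x) * ph x $ i * t i"
    "real (y x $ i) / (real (N x) * ph x $ i) = 1 + t i"
    "real (y x $ i) = real (N x) * ph x $ i * (1 + t i)"
    by (simp_all add: t_def field_simps)
  have "(e i x)\<^sup>2 = real (N x) * (real (y x $ i) / N x - ph x $ i)\<^sup>2"
    using good_n(2)[of x] by (simp add: e_def power_mult_distrib power2_eq_square)
  then show "real (N x) * ph x $ i * (t i)\<^sup>2 = (e i x)\<^sup>2 / ph x $ i"
    using pos by (simp add: t_def power_divide power2_eq_square)
qed

lemma pearson_eq:
  assumes g: "good x"
  shows "pearson (real_vec (y x)) (real (N x) *\<^sub>R ph x) = (\<Sum>i\<in>UNIV. (e i x)\<^sup>2 / ph x $ i)"
  unfolding pearson_def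
proof (rule sum.cong[OF refl])
  fix i
  have pos: "ph x $ i > 0" "real (N x) > 0" using good_ph(1)[OF g, of i] g by (auto simp: good_def)
  show "(real_vec (y x) $ i - (real (N x) *\<^sub>R ph x) $ i)\<^sup>2 / (real (N x) *\<^sub>R ph x) $ i = (e i x)\<^sup>2 / ph x $ i"
    unfolding term_eq(2)[OF g, symmetric]
    using pos by (simp add: real_vec_def term_eq(1)[OF g] power2_eq_square)
qed

text \<open>Replacing the denominators \<open>ph\<close> by \<open>p0\<close> costs
  \<open>o(1)\<close> because \<open>e\<close> is bounded; what remains is the squared norm of
  \<open>u\<close>.\<close>

theorem pearson_lim:
  assumes B: "orthonormal B" "span B = residual"
  shows "((\<lambda>x. pearson (real_vec (y x)) (real (N x) *\<^sub>R ph x) - (\<Sum>b\<in>B. (b \<bullet> W x)\<^sup>2)) \<longlongrightarrow> 0) F"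
proof (rule tendsto_good_cong)
  have "((\<lambda>x. 1 / ph x $ i - 1 / p0 $ i) \<longlongrightarrow> 1 / p0 $ i - 1 / p0 $ i) F" for i
    by (intro tendsto_intros ph_lim) (use p0_pos[of i] in simp_all)
  then have "((\<lambda>x. (\<Sum>i\<in>UNIV. (e i x)\<^sup>2 * (1 / ph x $ i - 1 / p0 $ i)) + ((norm (u x))\<^sup>2 - (\<Sum>b\<in>B. (b \<bullet> W x)\<^sup>2))) \<longlongrightarrow> 0 + 0) F"
    by (intro tendsto_add tendsto_null_sum bounded_null(3) norm_u_lim[OF B]) simp_all
  then show "((\<lambda>x. (\<Sum>i\<in>UNIV. (e i x)\<^sup>2 * (1 / ph x $ i - 1 / p0 $ i)) + ((norm (u x))\<^sup>2 - (\<Sum>b\<in>B. (b \<bullet> W x)\<^sup>2))) \<longlongrightarrow> 0) F"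
    by simp
  show "pearson (real_vec (y x)) (real (N x) *\<^sub>R ph x) - (\<Sum>b\<in>B. (b \<bullet> W x)\<^sup>2) =
    (\<Sum>i\<in>UNIV. (e i x)\<^sup>2 * (1 / ph x $ i - 1 / p0 $ i)) + ((norm (u x))\<^sup>2 - (\<Sum>b\<in>B. (b \<bullet> W x)\<^sup>2))" if "good x" for x
    by (simp add: pearson_eq[OF that] norm_u right_diff_distrib sum_subtractf)
qed

text \<open>In each cell \<open>2 * ((1 + t) * ln (1 + t) - t)\<close> is
  \<open>t\<^sup>2 + o(t\<^sup>2)\<close>, and the fitted count times \<open>t\<^sup>2\<close> stays
  bounded.\<close>

theorem bregman_pearson_lim:
  "((\<lambda>x. bregman (real_vec (y x)) (real (N x) *\<^sub>R ph x) - pearson (real_vec (y x)) (real (N x) *\<^sub>R ph x)) \<longlongrightarrow> 0) F"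
proof -
  define t where "t i x = (real (y x $ i) / N x - ph x $ i) / ph x $ i" for i x
  have diff_lim: "((\<lambda>x. real (y x $ i) / N x - ph x $ i) \<longlongrightarrow> 0) F" for i
  proof (rule tendsto_good_cong)
    show "((\<lambda>x. e i x * inverse (n x)) \<longlongrightarrow> 0) F" by (rule bounded_null(1)[OF inv_n])
    show "real (y x $ i) / N x - ph x $ i = e i x * inverse (n x)" if "good x" for x
      using good_n(1)[OF that] by (simp add: e_def)
  qed
  have t_lim: "(t i \<longlongrightarrow> 0) F" for i
  proof -
    have "(t i \<longlongrightarrow> 0 / p0 $ i) F"
      unfolding t_def by (intro tendsto_divide diff_lim ph_lim) (use p0_pos[of i] in simp)
    then show ?thesis by simp
  qed
  have "((\<lambda>x. \<Sum>i\<in>UNIV. (e i x)\<^sup>2 * (xlogx_rem (t i x) / ph x $ i)) \<longlongrightarrow> 0) F"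
  proof (intro tendsto_null_sum bounded_null(3))
    fix i
    have "((\<lambda>x. xlogx_rem (t i x) / ph x $ i) \<longlongrightarrow> 0 / p0 $ i) F"
      by (intro tendsto_divide tendsto_xlogx_rem t_lim ph_lim) (use p0_pos[of i] in simp)
    then show "((\<lambda>x. xlogx_rem (t i x) / ph x $ i) \<longlongrightarrow> 0) F" by simp
  qed
  \<comment> \<open>Past this point every observed count is positive, so the branch for
    \<open>0 log 0\<close> is not taken.\<close>
  moreover have "\<forall>\<^sub>F x in F. \<forall>i. t i x > - 1"
    by (intro eventually_all_finite order_tendstoD(1)[OF t_lim]) simp
  then have "\<forall>\<^sub>F x in F. (\<Sum>i\<in>UNIV. (e i x)\<^sup>2 * (xlogx_rem (t i x) / ph x $ i)) =
    bregman (real_vec (y x)) (real (N x) *\<^sub>R ph x) - pearson (real_vec (y x)) (real (N x) *\<^sub>R ph x)"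
    using ev_good
  proof eventually_elim
    case (elim x)
    note te = term_eq[OF elim(2), folded t_def]
    have "2 * ((if real_vec (y x) $ i = 0 then 0 else real_vec (y x) $ i * ln (real_vec (y x) $ i / (real (N x) *\<^sub>R ph x) $ i)) -
        (real_vec (y x) $ i - (real (N x) *\<^sub>R ph x) $ i)) = (e i x)\<^sup>2 / ph x $ i + (e i x)\<^sup>2 * (xlogx_rem (t i x) / ph x $ i)" for i
    proof -
      have pos: "ph x $ i > 0" "real (N x) > 0" using good_ph(1)[OF elim(2), of i] elim(2) by (auto simp: good_def)
      let ?m = "real (N x) * ph x $ i"
      have y_eq: "real (y x $ i) = ?m * (1 + t i x)" by (rule te(4))
      have "1 + t i x > 0" using elim(1)[rule_format, of i] by linarith
      then have "real (y x $ i) \<noteq> 0" unfolding y_eq using pos by simp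
      then have "2 * ((if real_vec (y x) $ i = 0 then 0 else real_vec (y x) $ i * ln (real_vec (y x) $ i / (real (N x) *\<^sub>R ph x) $ i)) -
        (real_vec (y x) $ i - (real (N x) *\<^sub>R ph x) $ i)) = 2 * (?m * (1 + t i x) * ln (1 + t i x) - ?m * t i x)"
        using te(1,3)[of i] y_eq by (simp add: real_vec_def)
      also have "\<dots> = ?m * (2 * ((1 + t i x) * ln (1 + t i x) - t i x))" by (simp add: algebra_simps)
      also have "\<dots> = ?m * (t i x)\<^sup>2 + ?m * (t i x)\<^sup>2 * xlogx_rem (t i x)"
        unfolding xlogx_eq_rem by (simp add: algebra_simps)
      finally show ?thesis unfolding te(2) by simp
    qed
    then have "bregman (real_vec (y x)) (real (N x) *\<^sub>R ph x) =
      (\<Sum>i\<in>UNIV. (e i x)\<^sup>2 / ph x $ i + (e i x)\<^sup>2 * (xlogx_rem (t i x) / ph x $ i))"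
      unfolding bregman_def sum_distrib_left by simp
    then show ?case by (simp add: pearson_eq[OF elim(2)] sum.distrib)
  qed
  ultimately show ?thesis by (rule Lim_transform_eventually)
qed

end

section \<open>Convergence in distribution\<close>

lemma abs_exp_minus_diff_le:
  fixes a b :: real
  assumes "a \<ge> 0" "b \<ge> 0"
  shows "\<bar>exp (- a) - exp (- b)\<bar> \<le> \<bar>a - b\<bar>" "\<bar>exp (- a) - exp (- b)\<bar> \<le> 1"
proof -
  have *: "exp (- a) - exp (- b) \<le> b - a" if "0 \<le> a" "a \<le> b" for a b :: real
  proof -
    have "exp (- a) - exp (- b) = exp (- a) * (1 - exp (- (b - a)))"
      by (simp add: right_diff_distrib exp_add[symmetric])
    also have "\<dots> \<le> 1 * (b - a)"
    proof (rule mult_mono)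
      show "1 - exp (- (b - a)) \<le> b - a" using exp_ge_add_one_self[of "- (b - a)"] by linarith
    qed (use that in auto)
    finally show ?thesis by simp
  qed
  show "\<bar>exp (- a) - exp (- b)\<bar> \<le> \<bar>a - b\<bar>"
    using *[of a b] *[of b a] assms by (cases "a \<le> b") auto
  have "0 < exp (- a)" "exp (- a) \<le> 1" "0 < exp (- b)" "exp (- b) \<le> 1" using assms by auto
  then show "\<bar>exp (- a) - exp (- b)\<bar> \<le> 1" by linarith
qed

text \<open>Restricting to \<open>E\<close> changes each distribution function by at most the
  probability of the complement. Agreement of \<open>S\<close> and \<open>T\<close> on
  \<open>E\<close> alone lets \<open>MLE\<close> take the place of \<open>aug_MLE\<close>.\<close>

lemma weak_conv_m_conditioned:
  fixes P :: "nat \<Rightarrow> 'a pmf" and S T :: "nat \<Rightarrow> 'a \<Rightarrow> real"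
  assumes T: "weak_conv_m (\<lambda>N. distr (P N) borel (T N)) \<mu>"
    and E: "(\<lambda>N. measure_pmf.prob (P N) E) \<longlonglongrightarrow> 1"
    and S: "\<And>N y. y \<in> E \<Longrightarrow> S N y = T N y"
  shows "weak_conv_m (\<lambda>N. distr (uniform_measure (P N) E) borel (S N)) \<mu>"
  unfolding weak_conv_m_def weak_conv_def
proof (intro allI impI)
  fix x assume "isCont (cdf \<mu>) x"
  then have lim: "(\<lambda>N. measure_pmf.prob (P N) {y. T N y \<le> x}) \<longlonglongrightarrow> cdf \<mu> x"
    using T by (simp add: weak_conv_m_def weak_conv_def cdf_def measure_distr vimage_def)
  have "(\<lambda>N. measure_pmf.prob (P N) {y. T N y \<le> x} - measure_pmf.prob (P N) (E \<inter> {y. T N y \<le> x})) \<longlonglongrightarrow> 0"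
  proof (rule tendsto_sandwich[OF _ _ tendsto_const])
    show "(\<lambda>N. 1 - measure_pmf.prob (P N) E) \<longlonglongrightarrow> 0"
      using tendsto_diff[OF tendsto_const E, of 1] by simp
    show "\<forall>\<^sub>F N in sequentially. 0 \<le> measure_pmf.prob (P N) {y. T N y \<le> x} - measure_pmf.prob (P N) (E \<inter> {y. T N y \<le> x})"
      by (auto intro!: always_eventually measure_pmf.finite_measure_mono)
    show "\<forall>\<^sub>F N in sequentially. measure_pmf.prob (P N) {y. T N y \<le> x} - measure_pmf.prob (P N) (E \<inter> {y. T N y \<le> x})
      \<le> 1 - measure_pmf.prob (P N) E"
    proof (intro always_eventually allI)
      fix N
      have "measure_pmf.prob (P N) {y. T N y \<le> x} \<le> measure_pmf.prob (P N) ((E \<inter> {y. T N y \<le> x}) \<union> - E)"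
        by (rule measure_pmf.finite_measure_mono) auto
      also have "\<dots> \<le> measure_pmf.prob (P N) (E \<inter> {y. T N y \<le> x}) + measure_pmf.prob (P N) (- E)"
        by (rule measure_Un_le) auto
      also have "measure_pmf.prob (P N) (- E) = 1 - measure_pmf.prob (P N) E"
        using measure_pmf.prob_compl[of E "P N"] by (simp add: Compl_eq_Diff_UNIV)
      finally show "measure_pmf.prob (P N) {y. T N y \<le> x} - measure_pmf.prob (P N) (E \<inter> {y. T N y \<le> x})
        \<le> 1 - measure_pmf.prob (P N) E" by simp
    qed
  qed
  from tendsto_diff[OF lim this]
  have "(\<lambda>N. measure_pmf.prob (P N) (E \<inter> {y. T N y \<le> x})) \<longlonglongrightarrow> cdf \<mu> x" by simp
  from tendsto_divide[OF this E]
  have "(\<lambda>N. measure_pmf.prob (P N) (E \<inter> {y. T N y \<le> x}) / measure_pmf.prob (P N) E) \<longlonglongrightarrow> cdf \<mu> x" by simp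
  moreover have "\<forall>\<^sub>F N in sequentially. measure_pmf.prob (P N) (E \<inter> {y. T N y \<le> x}) / measure_pmf.prob (P N) E =
     cdf (distr (uniform_measure (P N) E) borel (S N)) x"
  proof -
    have "\<forall>\<^sub>F N in sequentially. measure_pmf.prob (P N) E > 0"
      by (rule order_tendstoD(1)[OF E]) simp
    then show ?thesis
    proof eventually_elim
      case (elim N)
      have "E \<inter> {y. S N y \<le> x} = E \<inter> {y. T N y \<le> x}" using S by auto
      moreover have "emeasure (P N) E \<noteq> 0" using elim by (simp add: measure_pmf.emeasure_eq_measure)
      ultimately show ?case
        by (simp add: cdf_def measure_distr vimage_def measure_uniform_measure)
    qed
  qed
  ultimately show "(\<lambda>N. cdf (distr (uniform_measure (P N) E) borel (S N)) x) \<longlonglongrightarrow> cdf \<mu> x"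
    by (rule Lim_transform_eventually)
qed

context relational_model
begin

abbreviation "P N \<equiv> multinomial_pmf N p0"

lemma p0_nonneg: "p0$i \<ge> 0"
  using p0_pos[of i] by simp

lemma set_P: "set_pmf (P N) \<subseteq> count_vecs N"
  by (rule set_pmf_multinomial[OF p0_nonneg p0_sum])

lemma integrable_P: "integrable (P N) (f :: _ \<Rightarrow> real)"
  by (rule integrable_measure_pmf_finite[OF finite_set_pmf_multinomial[OF p0_nonneg p0_sum]])

lemma std_counts_orthogonal:
  assumes N: "N > 0" and y: "y \<in> count_vecs N"
  shows "orthogonal (\<chi> i. sqrt (p0$i)) (std_counts p0 N y)"
proof -
  have "(\<Sum>i\<in>UNIV. real (y$i)) = real N" using y by (simp add: count_vecs_def flip: of_nat_sum)
  then have "(\<Sum>i\<in>UNIV. sqrt N * (real (y$i) / N - p0$i)) = 0"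
    using N p0_sum by (simp add: sum_distrib_left[symmetric] sum_subtractf sum_divide_distrib[symmetric])
  moreover have "sqrt (p0$i) * std_counts p0 N y $ i = sqrt N * (real (y$i) / N - p0$i)" for i
    using p0_pos[of i] by (simp add: std_counts_nth[OF N])
  ultimately show ?thesis by (simp add: orthogonal_def inner_vec_def)
qed

text \<open>On the support \<open>W\<close> is orthogonal to \<open>sqrt p0\<close>, so its squared
  norm is \<open>Q\<close> for a basis of that complement. Its limiting Laplace transform tends to 1
  as \<open>s\<close> tends to 0, and Markov's inequality for \<open>1 - exp (- s * Q)\<close>
  bounds the tail.\<close>

lemma std_counts_tight:
  assumes \<epsilon>: "\<epsilon> > 0"
  obtains M where "\<forall>\<^sub>F N in sequentially. measure_pmf.prob (P N) {y. \<not> norm (std_counts p0 N y) \<le> M} < \<epsilon>"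
proof -
  let ?V = "{v. \<forall>x\<in>{\<chi> i. sqrt (p0$i)}. orthogonal x v}"
  have "subspace ?V" by (rule subspace_orthogonal_to_vectors)
  then obtain B where B: "orthonormal B" "B \<subseteq> ?V" "span B = ?V"
    by (rule orthonormal_basis_obtain)
  have "((\<lambda>s. (1 + 2 * s) powr (- real (card B) / 2)) \<longlongrightarrow> (1 + 2 * 0) powr (- real (card B) / 2)) (at_right (0::real))"
    by (intro tendsto_intros) auto
  then have "\<forall>\<^sub>F s in at_right (0::real). (1 + 2 * s) powr (- real (card B) / 2) > 1 - \<epsilon> / 2"
    by (intro order_tendstoD(1)) (use \<epsilon> in auto)
  then have "\<forall>\<^sub>F s in at_right (0::real). (1 + 2 * s) powr (- real (card B) / 2) > 1 - \<epsilon> / 2 \<and> s > 0"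
    using eventually_at_right_less[of 0] by eventually_elim auto
  then obtain s :: real where s: "s > 0" "(1 + 2 * s) powr (- real (card B) / 2) > 1 - \<epsilon> / 2"
    using eventually_happens'[OF trivial_limit_at_right_real] by blast
  have "(\<lambda>N. measure_pmf.expectation (P N) (\<lambda>y. exp (- (s * (\<Sum>b\<in>B. (b \<bullet> std_counts p0 N y)\<^sup>2)))))
    \<longlonglongrightarrow> (1 + 2 * s) powr (- real (card B) / 2)"
    by (rule tendsto_Laplace_std_counts[OF p0_pos p0_sum B(1)])
      (use B(2) s in \<open>auto simp: orthogonal_def inner_vec_def mult.commute\<close>)
  from order_tendstoD(1)[OF this s(2)] have
    "\<forall>\<^sub>F N in sequentially. measure_pmf.expectation (P N) (\<lambda>y. exp (- (s * (\<Sum>b\<in>B. (b \<bullet> std_counts p0 N y)\<^sup>2)))) > 1 - \<epsilon> / 2" .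
  \<comment> \<open>At norm \<open>sqrt (ln 2 / s)\<close> the exponential equals 1/2, so the tail
    indicator is at most \<open>2 * (1 - exp (- s * Q))\<close>; this 2 accounts for the
    \<open>\<epsilon> / 2\<close> above.\<close>
  then have "\<forall>\<^sub>F N in sequentially. measure_pmf.prob (P N) {y. \<not> norm (std_counts p0 N y) \<le> sqrt (ln 2 / s)} < \<epsilon>"
    using eventually_gt_at_top[of 0]
  proof eventually_elim
    case (elim N)
    let ?Q = "\<lambda>y. \<Sum>b\<in>B. (b \<bullet> std_counts p0 N y)\<^sup>2"
    have Q: "?Q y = (norm (std_counts p0 N y))\<^sup>2" if "y \<in> count_vecs N" for y
      using std_counts_orthogonal[OF elim(2) that] by (intro orthonormal_Parseval[symmetric] B(1)) (auto simp: B(3))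
    have "measure_pmf.prob (P N) {y. \<not> norm (std_counts p0 N y) \<le> sqrt (ln 2 / s)}
      = measure_pmf.expectation (P N) (indicator {y. \<not> norm (std_counts p0 N y) \<le> sqrt (ln 2 / s)})" by simp
    also have "\<dots> \<le> measure_pmf.expectation (P N) (\<lambda>y. 2 * (1 - exp (- (s * ?Q y))))"
    proof (rule integral_mono_AE[OF integrable_P integrable_P])
      show "AE y in P N. indicator {y. \<not> norm (std_counts p0 N y) \<le> sqrt (ln 2 / s)} y \<le> 2 * (1 - exp (- (s * ?Q y)))"
        unfolding AE_measure_pmf_iff
      proof
        fix y assume "y \<in> set_pmf (P N)"
        then have Qy: "?Q y = (norm (std_counts p0 N y))\<^sup>2" using set_P Q by blast
        show "indicator {y. \<not> norm (std_counts p0 N y) \<le> sqrt (ln 2 / s)} y \<le> 2 * (1 - exp (- (s * ?Q y)))"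
        proof (cases "norm (std_counts p0 N y) \<le> sqrt (ln 2 / s)")
          case True
          then show ?thesis using s by (simp add: sum_nonneg)
        next
          case False
          then have "(sqrt (ln 2 / s))\<^sup>2 \<le> (norm (std_counts p0 N y))\<^sup>2"
            using s by (intro power_mono) auto
          then have "ln 2 \<le> s * ?Q y" using s by (simp add: Qy field_simps)
          then have "exp (- (s * ?Q y)) \<le> exp (- ln 2)" by simp
          also have "\<dots> = 1 / 2" by (simp add: exp_minus)
          finally show ?thesis using False by simp
        qed
      qed
    qed
    also have "\<dots> = 2 * (1 - measure_pmf.expectation (P N) (\<lambda>y. exp (- (s * ?Q y))))"
      using integrable_P by simp
    also have "\<dots> < \<epsilon>" using elim by simp
    finally show ?case .
  qed
  then show thesis by (rule that)
qed

text \<open>A purely deterministic statement; probability enters afterwards, through the mass of the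
  count vectors with norm above \<open>M\<close>.\<close>

lemma uniformly_close:
  assumes B: "orthonormal B" "span B = residual"
    and \<epsilon>: "\<epsilon> > 0"
  shows "\<forall>\<^sub>F N in sequentially. \<forall>y\<in>count_vecs N. norm (std_counts p0 N y) \<le> M \<longrightarrow> y \<in> MLE_exists_set A \<and>
      \<bar>pearson (real_vec y) (real N *\<^sub>R MLE A y) - (\<Sum>b\<in>B. (b \<bullet> std_counts p0 N y)\<^sup>2)\<bar> < \<epsilon> \<and>
      \<bar>bregman (real_vec y) (real N *\<^sub>R MLE A y) - (\<Sum>b\<in>B. (b \<bullet> std_counts p0 N y)\<^sup>2)\<bar> < \<epsilon>"
proof -
  \<comment> \<open>limits along this filter are limits in \<open>N\<close> uniform over all \<open>y\<close> with bounded standardisation\<close>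
  define F where "F = inf (filtercomap fst sequentially)
    (principal {(N, y). y \<in> count_vecs N \<and> norm (std_counts p0 N y) \<le> M})"
  have fst: "filterlim fst sequentially F"
    unfolding F_def by (rule filterlim_mono[OF filterlim_filtercomap]) auto
  have in_set: "\<forall>\<^sub>F x in F. snd x \<in> count_vecs (fst x) \<and> norm (std_counts p0 (fst x) (snd x)) \<le> M"
    unfolding F_def eventually_inf_principal by (auto intro!: always_eventually)
  \<comment> \<open>The smallness condition of \<open>MLE_exists\<close> with \<open>M\<close> in
    place of the norm, which supplies maximisers along \<open>F\<close>.\<close>
  have "\<forall>\<^sub>F N in sequentially. N > 0 \<and> (\<forall>i. 3 * M \<le> sqrt (real N) * (p0$i / 2))"
  proof (intro eventually_conj eventually_gt_at_top eventually_all_finite)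
    fix i
    have "filterlim (\<lambda>N. sqrt (real N) * (p0$i / 2)) at_top sequentially"
      by (rule filterlim_at_top_mult_tendsto_pos[OF tendsto_const])
        (use p0_pos[of i] in \<open>auto intro!: filterlim_compose[OF sqrt_at_top filterlim_real_sequentially]\<close>)
    then show "\<forall>\<^sub>F N in sequentially. 3 * M \<le> sqrt (real N) * (p0$i / 2)"
      unfolding filterlim_at_top by blast
  qed
  from eventually_compose_filterlim[OF this fst] in_set
  have ex: "\<forall>\<^sub>F x in F. snd x \<in> MLE_exists_set A"
  proof eventually_elim
    case (elim x)
    show ?case
    proof (rule MLE_exists[of "fst x"])
      fix i show "3 * norm (std_counts p0 (fst x) (snd x)) \<le> sqrt (fst x) * (p0$i / 2)"
      proof -
        have "3 * norm (std_counts p0 (fst x) (snd x)) \<le> 3 * M" using elim by simp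
        also have "\<dots> \<le> sqrt (fst x) * (p0$i / 2)" using elim by blast
        finally show ?thesis .
      qed
    qed (use elim in auto)
  qed
  interpret MLE_limit A p0 F fst snd "\<lambda>x. MLE A (snd x)" M
  proof
    show "\<forall>\<^sub>F x in F. MLE_spec A (snd x) (MLE A (snd x))"
      using ex by eventually_elim (rule MLE_spec_MLE)
  qed (use fst in_set in \<open>auto elim: eventually_mono\<close>)
  have "\<forall>\<^sub>F x in F. \<bar>pearson (real_vec (snd x)) (real (fst x) *\<^sub>R MLE A (snd x)) - (\<Sum>b\<in>B. (b \<bullet> W x)\<^sup>2)\<bar> < \<epsilon>"
    using tendstoD[OF pearson_lim[OF B] \<epsilon>] by simp
  moreover have "\<forall>\<^sub>F x in F. \<bar>bregman (real_vec (snd x)) (real (fst x) *\<^sub>R MLE A (snd x)) - (\<Sum>b\<in>B. (b \<bullet> W x)\<^sup>2)\<bar> < \<epsilon>"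
    using tendstoD[OF tendsto_add[OF bregman_pearson_lim pearson_lim[OF B]], of \<epsilon>] \<epsilon> by simp
  ultimately have "\<forall>\<^sub>F x in F. snd x \<in> MLE_exists_set A \<and>
      \<bar>pearson (real_vec (snd x)) (real (fst x) *\<^sub>R MLE A (snd x)) - (\<Sum>b\<in>B. (b \<bullet> W x)\<^sup>2)\<bar> < \<epsilon> \<and>
      \<bar>bregman (real_vec (snd x)) (real (fst x) *\<^sub>R MLE A (snd x)) - (\<Sum>b\<in>B. (b \<bullet> W x)\<^sup>2)\<bar> < \<epsilon>"
    using ex by eventually_elim auto
  then show ?thesis
    unfolding F_def eventually_inf_principal eventually_filtercomap
    by (auto elim!: eventually_mono)
qed

text \<open>Where the norm is at most \<open>M\<close> the two exponentials are close by the
  Lipschitz bound; elsewhere they differ by at most 1, both exponents being nonnegative, and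
  tightness makes that event rare. This is why \<open>T\<close> must be nonnegative even where no
  maximiser exists.\<close>

lemma weak_conv_m_statistic:
  assumes B: "orthonormal B" "B \<subseteq> residual" "card B = kernel_dim A"
    and nonneg: "\<And>N y. y \<in> count_vecs N \<Longrightarrow> 0 \<le> T N y"
    and close: "\<And>M \<epsilon>. \<epsilon> > 0 \<Longrightarrow> \<forall>\<^sub>F N in sequentially. \<forall>y\<in>count_vecs N. norm (std_counts p0 N y) \<le> M \<longrightarrow>
        \<bar>T N y - (\<Sum>b\<in>B. (b \<bullet> std_counts p0 N y)\<^sup>2)\<bar> < \<epsilon>"
  shows "weak_conv_m (\<lambda>N. distr (P N) borel (T N)) (chi_square (kernel_dim A))"
proof (rule weak_conv_m_Laplace)
  show "real_distribution (distr (P N) borel (T N))" for N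
    by (rule prob_space.real_distribution_distr[OF prob_space_measure_pmf]) simp
  show "AE x in distr (P N) borel (T N). 0 \<le> x" for N
    using nonneg set_P by (subst AE_distr_iff) (auto simp: AE_measure_pmf_iff)
  show "real_distribution (chi_square (kernel_dim A))" "AE x in chi_square (kernel_dim A). 0 \<le> x"
    by (rule real_distribution_chi_square AE_chi_square_nonneg)+
  fix k :: nat
  let ?Q = "\<lambda>N y. \<Sum>b\<in>B. (b \<bullet> std_counts p0 N y)\<^sup>2"
  have "(\<lambda>N. measure_pmf.expectation (P N) (\<lambda>y. exp (- (real k * T N y))) -
      measure_pmf.expectation (P N) (\<lambda>y. exp (- (real k * ?Q N y)))) \<longlonglongrightarrow> 0"
  proof (rule tendstoI)
    fix \<epsilon> :: real assume \<epsilon>: "\<epsilon> > 0"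
    obtain M where M: "\<forall>\<^sub>F N in sequentially. measure_pmf.prob (P N) {y. \<not> norm (std_counts p0 N y) \<le> M} < \<epsilon> / 2"
      using std_counts_tight[of "\<epsilon> / 2"] \<epsilon> by auto
    \<comment> \<open>The summand 1 in \<open>real k + 1\<close> keeps \<delta> positive when
      \<open>k = 0\<close>.\<close>
    define \<delta> where "\<delta> = \<epsilon> / 2 / (real k + 1)"
    have \<delta>: "\<delta> > 0" "real k * \<delta> \<le> \<epsilon> / 2" using \<epsilon> by (auto simp: \<delta>_def field_simps)
    from M close[OF \<delta>(1), of M]
    show "\<forall>\<^sub>F N in sequentially. dist (measure_pmf.expectation (P N) (\<lambda>y. exp (- (real k * T N y))) -
      measure_pmf.expectation (P N) (\<lambda>y. exp (- (real k * ?Q N y)))) 0 < \<epsilon>"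
    proof eventually_elim
      case (elim N)
      have "\<bar>measure_pmf.expectation (P N) (\<lambda>y. exp (- (real k * T N y))) -
        measure_pmf.expectation (P N) (\<lambda>y. exp (- (real k * ?Q N y)))\<bar>
        = \<bar>measure_pmf.expectation (P N) (\<lambda>y. exp (- (real k * T N y)) - exp (- (real k * ?Q N y)))\<bar>"
        by (simp add: integrable_P)
      also have "\<dots> \<le> measure_pmf.expectation (P N) (\<lambda>y. \<bar>exp (- (real k * T N y)) - exp (- (real k * ?Q N y))\<bar>)"
        by (rule integral_abs_bound)
      also have "\<dots> \<le> measure_pmf.expectation (P N) (\<lambda>y. \<epsilon> / 2 + indicator {y. \<not> norm (std_counts p0 N y) \<le> M} y)"
      proof (rule integral_mono_AE[OF integrable_P integrable_P])
        show "AE y in P N. \<bar>exp (- (real k * T N y)) - exp (- (real k * ?Q N y))\<bar> \<le> \<epsilon> / 2 + indicator {y. \<not> norm (std_counts p0 N y) \<le> M} y"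
          unfolding AE_measure_pmf_iff
        proof
          fix y assume "y \<in> set_pmf (P N)"
          then have y: "y \<in> count_vecs N" using set_P by blast
          have nn: "0 \<le> real k * T N y" "0 \<le> real k * ?Q N y"
            using nonneg[OF y] by (auto intro!: mult_nonneg_nonneg sum_nonneg)
          show "\<bar>exp (- (real k * T N y)) - exp (- (real k * ?Q N y))\<bar> \<le> \<epsilon> / 2 + indicator {y. \<not> norm (std_counts p0 N y) \<le> M} y"
          proof (cases "norm (std_counts p0 N y) \<le> M")
            case True
            have "\<bar>exp (- (real k * T N y)) - exp (- (real k * ?Q N y))\<bar> \<le> \<bar>real k * T N y - real k * ?Q N y\<bar>"
              by (rule abs_exp_minus_diff_le(1)[OF nn])
            also have "\<dots> = real k * \<bar>T N y - ?Q N y\<bar>"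
              by (simp only: right_diff_distrib[symmetric] abs_mult abs_of_nat)
            also have "\<dots> \<le> real k * \<delta>" using elim(2) y True by (intro mult_left_mono) (auto simp: less_imp_le)
            finally show ?thesis using \<delta>(2) True by simp
          next
            case False
            then show ?thesis using abs_exp_minus_diff_le(2)[OF nn] \<epsilon> by simp
          qed
        qed
      qed
      also have "\<dots> = \<epsilon> / 2 + measure_pmf.prob (P N) {y. \<not> norm (std_counts p0 N y) \<le> M}"
        by (subst Bochner_Integration.integral_add) (auto simp: integrable_P)
      also have "\<dots> < \<epsilon>" using elim(1) by simp
      finally show ?case by simp
    qed
  qed
  moreover have "(\<lambda>N. measure_pmf.expectation (P N) (\<lambda>y. exp (- (real k * ?Q N y))))
    \<longlonglongrightarrow> (1 + 2 * real k) powr (- real (card B) / 2)"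
    by (rule tendsto_Laplace_std_counts[OF p0_pos p0_sum B(1)])
      (use B(2) residual_sqrt_sum in auto)
  ultimately have "(\<lambda>N. measure_pmf.expectation (P N) (\<lambda>y. exp (- (real k * T N y))))
    \<longlonglongrightarrow> (1 + 2 * real k) powr (- real (kernel_dim A) / 2)"
    unfolding B(3) by (rule Lim_transform[rotated])
  then show "(\<lambda>N. \<integral>x. exp (- (real k * x)) \<partial>distr (P N) borel (T N)) \<longlonglongrightarrow> (\<integral>x. exp (- (real k * x)) \<partial>chi_square (kernel_dim A))"
    by (simp add: integral_distr integral_exp_chi_square)
qed

lemma aug_MLE_pos: "aug_MLE A y $ i > 0"
proof (cases "y \<in> MLE_exists_set A")
  case True
  then have "MLE A y \<in> RM_p A" using MLE_spec_MLE by (auto simp: MLE_spec_def)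
  then show ?thesis using True RM_pD(1) by (simp add: aug_MLE_def)
qed (simp add: aug_MLE_def)

lemma pearson_aug_nonneg: "0 \<le> pearson (real_vec y) (real N *\<^sub>R aug_MLE A y)"
  unfolding pearson_def using aug_MLE_pos by (intro sum_nonneg divide_nonneg_nonneg) (auto simp: less_imp_le)

text \<open>Each cell is nonnegative by \<open>ln x \<le> x - 1\<close> at \<open>x = v / u\<close>.
  The case \<open>N = 0\<close> stands apart because the fitted counts are then zero.\<close>

lemma bregman_aug_nonneg:
  assumes y: "y \<in> count_vecs N"
  shows "0 \<le> bregman (real_vec y) (real N *\<^sub>R aug_MLE A y)"
proof (cases "N = 0")
  case True
  then have "y $ i = 0" for i using y by (simp add: count_vecs_def)
  then show ?thesis using True by (simp add: bregman_def real_vec_def)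
next
  case False
  have ge: "0 \<le> (if u = 0 then 0 else u * ln (u / v)) - (u - v)" if "u \<ge> 0" "v > 0" for u v :: real
  proof (cases "u = 0")
    case False
    then have u: "u > 0" using that by simp
    have "u * ln (v / u) \<le> u * (v / u - 1)"
      using u that by (intro mult_left_mono ln_le_minus_one) auto
    then show ?thesis using u that by (simp add: ln_div algebra_simps)
  qed (use that in simp)
  show ?thesis
    unfolding bregman_def using aug_MLE_pos False
    by (intro mult_nonneg_nonneg sum_nonneg ge) (auto simp: real_vec_def)
qed

end

theorem theorem4p4:
  fixes A :: "real^'i::finite^'j::finite" and p0 :: "real^'i"
  assumes zero_one: "\<forall>j i. A$j$i = 0 \<or> A$j$i = 1"
    and full_row_rank: "rank A = CARD('j)"
    and col_one: "\<forall>i. \<exists>j. A$j$i = 1"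
    and p0: "p0 \<in> RM_p A"
  shows
    "weak_conv_m (\<lambda>N. distr (uniform_measure (multinomial N p0) (MLE_exists_set A)) borel
        (\<lambda>y. pearson (real_vec y) (real N *\<^sub>R MLE A y))) (chi_square (kernel_dim A))
   \<and> weak_conv_m (\<lambda>N. distr (uniform_measure (multinomial N p0) (MLE_exists_set A)) borel
        (\<lambda>y. bregman (real_vec y) (real N *\<^sub>R MLE A y))) (chi_square (kernel_dim A))
   \<and> weak_conv_m (\<lambda>N. distr (multinomial N p0) borel
        (\<lambda>y. pearson (real_vec y) (real N *\<^sub>R aug_MLE A y))) (chi_square (kernel_dim A))
   \<and> weak_conv_m (\<lambda>N. distr (multinomial N p0) borel
        (\<lambda>y. bregman (real_vec y) (real N *\<^sub>R aug_MLE A y))) (chi_square (kernel_dim A))"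
proof -
  interpret relational_model A p0 by standard (fact zero_one col_one p0)+
  obtain B where B: "orthonormal B" "B \<subseteq> residual" "card B = kernel_dim A" "span B = residual"
    using orthonormal_basis_obtain[OF subspace_residual] unfolding dim_residual .
  have multi: "multinomial N p0 = measure_pmf (P N)" for N
    by (rule multinomial_eq_pmf[OF p0_nonneg p0_sum])
  note close = uniformly_close[OF B(1,4)]
  \<comment> \<open>Where \<open>close\<close> applies the maximiser exists, so
    \<open>aug_MLE\<close> coincides with \<open>MLE\<close> there.\<close>
  have pearson: "weak_conv_m (\<lambda>N. distr (P N) borel
      (\<lambda>y. pearson (real_vec y) (real N *\<^sub>R aug_MLE A y))) (chi_square (kernel_dim A))"
  proof (rule weak_conv_m_statistic[OF B(1,2,3) pearson_aug_nonneg])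
    show "\<forall>\<^sub>F N in sequentially. \<forall>y\<in>count_vecs N. norm (std_counts p0 N y) \<le> M \<longrightarrow>
        \<bar>pearson (real_vec y) (real N *\<^sub>R aug_MLE A y) - (\<Sum>b\<in>B. (b \<bullet> std_counts p0 N y)\<^sup>2)\<bar> < \<epsilon>" if "\<epsilon> > 0" for M \<epsilon>
      using close[OF that, of M] by eventually_elim (simp add: aug_MLE_def)
  qed
  have bregman: "weak_conv_m (\<lambda>N. distr (P N) borel
      (\<lambda>y. bregman (real_vec y) (real N *\<^sub>R aug_MLE A y))) (chi_square (kernel_dim A))"
  proof (rule weak_conv_m_statistic[OF B(1,2,3) bregman_aug_nonneg])
    show "\<forall>\<^sub>F N in sequentially. \<forall>y\<in>count_vecs N. norm (std_counts p0 N y) \<le> M \<longrightarrow>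
        \<bar>bregman (real_vec y) (real N *\<^sub>R aug_MLE A y) - (\<Sum>b\<in>B. (b \<bullet> std_counts p0 N y)\<^sup>2)\<bar> < \<epsilon>" if "\<epsilon> > 0" for M \<epsilon>
      using close[OF that, of M] by eventually_elim (simp add: aug_MLE_def)
  qed
  have E: "(\<lambda>N. measure_pmf.prob (P N) (MLE_exists_set A)) \<longlonglongrightarrow> 1"
  proof (rule tendstoI)
    fix \<epsilon> :: real assume "\<epsilon> > 0"
    then obtain M where "\<forall>\<^sub>F N in sequentially. measure_pmf.prob (P N) {y. \<not> norm (std_counts p0 N y) \<le> M} < \<epsilon>"
      by (rule std_counts_tight)
    \<comment> \<open>The tolerance 1 is arbitrary: what is taken from \<open>close\<close> is
      existence for all data with norm at most \<open>M\<close>.\<close>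
    with close[OF zero_less_one, of M]
    show "\<forall>\<^sub>F N in sequentially. dist (measure_pmf.prob (P N) (MLE_exists_set A)) 1 < \<epsilon>"
    proof eventually_elim
      case (elim N)
      have "measure_pmf.prob (P N) (- MLE_exists_set A) \<le> measure_pmf.prob (P N) {y. \<not> norm (std_counts p0 N y) \<le> M}"
        using elim(1) set_P[of N] by (intro measure_pmf.finite_measure_mono_AE) (auto simp: AE_measure_pmf_iff)
      moreover have "measure_pmf.prob (P N) (- MLE_exists_set A) = 1 - measure_pmf.prob (P N) (MLE_exists_set A)"
        using measure_pmf.prob_compl[of "MLE_exists_set A" "P N"] by (simp add: Compl_eq_Diff_UNIV)
      moreover have "measure_pmf.prob (P N) (MLE_exists_set A) \<le> 1" by simp
      ultimately show ?case using elim(2) by (simp add: dist_real_def)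
    qed
  qed
  show ?thesis
    unfolding multi
    by (intro conjI pearson bregman weak_conv_m_conditioned[OF pearson E] weak_conv_m_conditioned[OF bregman E])
      (simp_all add: aug_MLE_def)
qed

end
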